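(* Let $m\geqslant3$ and let $A$ be the Artin-Tits group of type $I_{2m}$, with standard generating set $S=\{a,b\}$ and Garside element $\Delta$. Then $$X_P^A\sim X_{NP}^A\preccurlyeq X_{abs}^A\sim S\cup\langle\Delta^2\rangle,$$ where the middle inequality is strict (that is, $X_{abs}^A\preccurlyeq X_{NP}^A$ does not hold). All the sets mentioned, namely $X_P^A$, $X_{NP}^A$, $X_{abs}^A$ and $S\cup\langle\Delta^2\rangle$, are hyperbolic structures on $A$, and the corresponding Cayley graphs all have infinite diameter.
   Context: The Artin-Tits group of type $I_{2m}$ is $A=\langle a,b\mid \Pi(a,b;m)=\Pi(b,a;m)\rangle$, where $\Pi(x,y;m)=xyx\cdots$ is the alternating word of length $m$ starting with $x$. Its Garside element is $\Delta=\Pi(a,b;m)$. Let $A^+$ be the submonoid of $A$ generated by $a,b$. For $x\in A$, $\inf(x)=\max\{k\in\mathbb Z: \Delta^{-k}x\in A^+\}$ and $\sup(x)=\min\{k\in\mathbb Z: x^{-1}\Delta^k\in A^+\}$. An element $y\in A$ is absorbable if $\inf(y)=0$ or $\sup(y)=0$, and there exists $x\in A$ such that $\inf(xy)=\inf(x)$ and $\sup(xy)=\sup(x)$. The proper irreducible standard parabolic subgroups of $A$ are $\langle a\rangle$ and $\langle b\rangle$. Define: - $X_P^A=\langle a\rangle\cup\langle b\rangle\cup\langle\Delta^2\rangle$; - $X_{NP}^A=N_A(\langle a\rangle)\cup N_A(\langle b\rangle)$, the union of the normalizers in $A$; - $X_{abs}^A$ is the union of the set of absorbable elements of $A$ and $\langle\Delta^2\rangle$.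 For a generating set $X$ of a group $G$, $d_X$ is the word metric; $X$ is a hyperbolic structure on $G$ if $(G,d_X)$ (equivalently the Cayley graph $\Gamma(G,X)$) is Gromov-hyperbolic. For generating sets $X,Y$ of $G$, write $X\preccurlyeq Y$ if the identity map $(G,d_Y)\to(G,d_X)$ is Lipschitz, equivalently $\sup_{y\in Y}d_X(1_G,y)<\infty$. Write $X\sim Y$ ($X$ and $Y$ are equivalent) if $X\preccurlyeq Y$ and $Y\preccurlyeq X$. *)

theory Defs
  imports
    "HOL-Algebra.Generated_Groups"
    "HOL-Algebra.Group_Action"
    "HOL-Analysis.Abstract_Metric_Spaces"
    "HOL-Library.Extended_Real"
begin

text \<open>A letter \<open>(x, True)\<close> stands for the generator \<open>x\<close>, and \<open>(x, False)\<close> for its formal inverse.\<close>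

type_synonym 'g sword = "('g \<times> bool) list"

inductive pres_eq :: "('g sword \<times> 'g sword) set \<Rightarrow> 'g sword \<Rightarrow> 'g sword \<Rightarrow> bool" for R where
  refl: "pres_eq R u u"
| sym: "pres_eq R u v \<Longrightarrow> pres_eq R v u"
| trans: "pres_eq R u v \<Longrightarrow> pres_eq R v w \<Longrightarrow> pres_eq R u w"
| cancel: "pres_eq R (u @ [(x, e), (x, \<not> e)] @ v) (u @ v)"
| relation: "(r, s) \<in> R \<Longrightarrow> pres_eq R (u @ r @ v) (u @ s @ v)"

definition pres_rel :: "('g sword \<times> 'g sword) set \<Rightarrow> ('g sword \<times> 'g sword) set" where
  "pres_rel R = {(u, v). pres_eq R u v}"

definition pres_class :: "('g sword \<times> 'g sword) set \<Rightarrow> 'g sword \<Rightarrow> 'g sword set" where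
  "pres_class R w = pres_rel R `` {w}"

definition presented_group :: "('g sword \<times> 'g sword) set \<Rightarrow> 'g sword set monoid" where
  "presented_group R =
     \<lparr>carrier = UNIV // pres_rel R,
      mult = (\<lambda>U V. \<Union>u\<in>U. \<Union>v\<in>V. pres_class R (u @ v)),
      one = pres_class R []\<rparr>"

lemma pres_eq_append_left: "pres_eq R u v \<Longrightarrow> pres_eq R (w @ u) (w @ v)"
proof (induction rule: pres_eq.induct)
  case (cancel u x e v)
  show ?case using pres_eq.cancel[of R "w @ u" x e v] by simp
next
  case (relation r s u v)
  then show ?case using pres_eq.relation[of r s R "w @ u" v] by simp
qed (blast intro: pres_eq.refl pres_eq.sym pres_eq.trans)+

lemma pres_eq_append_right: "pres_eq R u v \<Longrightarrow> pres_eq R (u @ w) (v @ w)"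
proof (induction rule: pres_eq.induct)
  case (cancel u x e v)
  show ?case using pres_eq.cancel[of R u x e "v @ w"] by simp
next
  case (relation r s u v)
  then show ?case using pres_eq.relation[of r s R u "v @ w"] by simp
qed (blast intro: pres_eq.refl pres_eq.sym pres_eq.trans)+

lemma pres_eq_append:
  assumes "pres_eq R u u'" "pres_eq R v v'"
  shows "pres_eq R (u @ v) (u' @ v')"
  by (rule pres_eq.trans[OF pres_eq_append_right[OF assms(1)] pres_eq_append_left[OF assms(2)]])

lemma pres_class_eq_iff: "pres_class R u = pres_class R v \<longleftrightarrow> pres_eq R u v"
proof
  assume "pres_class R u = pres_class R v"
  moreover have "v \<in> pres_class R v"
    by (simp add: pres_class_def pres_rel_def pres_eq.refl)
  ultimately have "v \<in> pres_class R u" by simp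
  then show "pres_eq R u v"
    by (simp add: pres_class_def pres_rel_def)
next
  assume uv: "pres_eq R u v"
  have "pres_eq R u w \<longleftrightarrow> pres_eq R v w" for w
    using pres_eq.trans[OF uv, of w] pres_eq.trans[OF pres_eq.sym[OF uv], of w] by blast
  then show "pres_class R u = pres_class R v"
    by (auto simp: pres_class_def pres_rel_def)
qed

lemma carrier_presented_group: "carrier (presented_group R) = range (pres_class R)"
  by (auto simp: presented_group_def quotient_def pres_class_def)

lemma one_presented_group: "\<one>\<^bsub>presented_group R\<^esub> = pres_class R []"
  by (simp add: presented_group_def)

lemma mult_presented_group:
  "pres_class R u \<otimes>\<^bsub>presented_group R\<^esub> pres_class R v = pres_class R (u @ v)"
proof -
  have same: "pres_class R (u' @ v') = pres_class R (u @ v)"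
    if "u' \<in> pres_class R u" "v' \<in> pres_class R v" for u' v'
    using that pres_eq_append[of R u u' v v'] pres_class_eq_iff[of R "u @ v" "u' @ v'"]
    by (simp add: pres_class_def pres_rel_def)
  have ne: "pres_class R u \<noteq> {}" "pres_class R v \<noteq> {}"
    by (auto simp: pres_class_def pres_rel_def intro: pres_eq.refl)
  have "pres_class R u \<otimes>\<^bsub>presented_group R\<^esub> pres_class R v
      = (\<Union>u'\<in>pres_class R u. \<Union>v'\<in>pres_class R v. pres_class R (u' @ v'))"
    by (simp add: presented_group_def)
  also have "\<dots> = (\<Union>u'\<in>pres_class R u. \<Union>v'\<in>pres_class R v. pres_class R (u @ v))"
    by (intro SUP_cong HOL.refl same)
  also have "\<dots> = pres_class R (u @ v)"
    using ne by simp
  finally show ?thesis .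
qed

definition inv_sword :: "'g sword \<Rightarrow> 'g sword" where
  "inv_sword w = rev (map (\<lambda>(x, e). (x, \<not> e)) w)"

lemma pres_eq_inv_sword: "pres_eq R (inv_sword w @ w) []"
proof (induction w)
  case Nil
  show ?case by (simp add: inv_sword_def pres_eq.refl)
next
  case (Cons p w)
  obtain x e where p: "p = (x, e)" by fastforce
  have "pres_eq R (inv_sword w @ [(x, \<not> e), (x, \<not> \<not> e)] @ w) (inv_sword w @ w)"
    by (rule pres_eq.cancel)
  then show ?case
    using pres_eq.trans[OF _ Cons.IH] by (simp add: inv_sword_def p)
qed

lemma group_presented_group: "group (presented_group R)"
proof (rule groupI)
  fix x assume "x \<in> carrier (presented_group R)"
  then obtain w where "x = pres_class R w"
    by (auto simp: carrier_presented_group)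
  then show "\<exists>y\<in>carrier (presented_group R). y \<otimes>\<^bsub>presented_group R\<^esub> x = \<one>\<^bsub>presented_group R\<^esub>"
    by (intro bexI[of _ "pres_class R (inv_sword w)"])
      (auto simp: carrier_presented_group one_presented_group mult_presented_group
        pres_class_eq_iff pres_eq_inv_sword)
qed (auto simp: carrier_presented_group one_presented_group mult_presented_group)


definition word_norm :: "('a, 'c) monoid_scheme \<Rightarrow> 'a set \<Rightarrow> 'a \<Rightarrow> nat" where
  "word_norm G X g =
     (LEAST n. \<exists>ws. set ws \<subseteq> X \<union> set_inv\<^bsub>G\<^esub> X \<and> length ws = n \<and>
        foldr (\<otimes>\<^bsub>G\<^esub>) ws \<one>\<^bsub>G\<^esub> = g)"

text \<open>The distance is set to 0 outside the carrier because \<^locale>\<open>Metric_space\<close> demands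
  symmetry for all arguments.\<close>

definition word_dist :: "('a, 'c) monoid_scheme \<Rightarrow> 'a set \<Rightarrow> 'a \<Rightarrow> 'a \<Rightarrow> real" where
  "word_dist G X g h =
     (if g \<in> carrier G \<and> h \<in> carrier G
      then real (word_norm G X (inv\<^bsub>G\<^esub> g \<otimes>\<^bsub>G\<^esub> h)) else 0)"

definition word_metric :: "('a, 'c) monoid_scheme \<Rightarrow> 'a set \<Rightarrow> 'a metric" where
  "word_metric G X = metric (carrier G, word_dist G X)"

definition generating_set :: "('a, 'c) monoid_scheme \<Rightarrow> 'a set \<Rightarrow> bool" where
  "generating_set G X \<longleftrightarrow> X \<subseteq> carrier G \<and> generate G X = carrier G"

text \<open>\<^const>\<open>word_norm\<close> and \<^const>\<open>word_metric\<close> are meaningful only for a generating set, where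
  the following lemma shows that the word metric is a metric.\<close>

context group
begin

lemma foldr_mult_closed:
  "set ws \<subseteq> carrier G \<Longrightarrow> foldr (\<otimes>) ws \<one> \<in> carrier G"
  by (induction ws) auto

lemma foldr_mult_append:
  "set us \<subseteq> carrier G \<Longrightarrow> set vs \<subseteq> carrier G \<Longrightarrow>
   foldr (\<otimes>) (us @ vs) \<one> = foldr (\<otimes>) us \<one> \<otimes> foldr (\<otimes>) vs \<one>"
  by (induction us) (auto simp: foldr_mult_closed m_assoc)

lemma foldr_mult_rev_inv:
  "set ws \<subseteq> carrier G \<Longrightarrow>
   foldr (\<otimes>) (rev (map (m_inv G) ws)) \<one> = inv (foldr (\<otimes>) ws \<one>)"
proof (induction ws)
  case (Cons x ws)
  have "set (rev (map (m_inv G) ws)) \<subseteq> carrier G" "set [inv x] \<subseteq> carrier G"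
    using Cons.prems by auto
  then have "foldr (\<otimes>) (rev (map (m_inv G) ws) @ [inv x]) \<one>
      = foldr (\<otimes>) (rev (map (m_inv G) ws)) \<one> \<otimes> foldr (\<otimes>) [inv x] \<one>"
    by (rule foldr_mult_append)
  then show ?case
    using Cons by (simp add: inv_mult_group foldr_mult_closed)
qed simp

lemma set_inv_carrier: "X \<subseteq> carrier G \<Longrightarrow> X \<union> set_inv X \<subseteq> carrier G"
  by (auto simp: SET_INV_def)

lemma set_inv_closed:
  "X \<subseteq> carrier G \<Longrightarrow> x \<in> X \<union> set_inv X \<Longrightarrow> inv x \<in> X \<union> set_inv X"
  by (auto simp: SET_INV_def)

lemma generate_imp_word:
  assumes "X \<subseteq> carrier G" "g \<in> generate G X"
  shows "\<exists>ws. set ws \<subseteq> X \<union> set_inv X \<and> foldr (\<otimes>) ws \<one> = g"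
  using assms(2)
proof (induction rule: generate.induct)
  case one
  show ?case by (intro exI[of _ "[]"]) simp
next
  case (incl h)
  then show ?case using assms(1) by (intro exI[of _ "[h]"]) auto
next
  case (inv h)
  then show ?case using assms(1) by (intro exI[of _ "[inv h]"]) (auto simp: SET_INV_def)
next
  case (eng h1 h2)
  then obtain us vs where "set us \<subseteq> X \<union> set_inv X" "foldr (\<otimes>) us \<one> = h1"
    "set vs \<subseteq> X \<union> set_inv X" "foldr (\<otimes>) vs \<one> = h2" by blast
  then show ?case
    using foldr_mult_append[of us vs] set_inv_carrier[OF assms(1)]
    by (intro exI[of _ "us @ vs"]) auto
qed

lemma word_norm_attained:
  assumes "generating_set G X" "g \<in> carrier G"
  obtains ws where "set ws \<subseteq> X \<union> set_inv X" "length ws = word_norm G X g"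
    "foldr (\<otimes>) ws \<one> = g"
proof -
  let ?P = "\<lambda>n. \<exists>ws. set ws \<subseteq> X \<union> set_inv X \<and> length ws = n \<and> foldr (\<otimes>) ws \<one> = g"
  have "\<exists>n. ?P n"
    using assms generate_imp_word[of X g] by (auto simp: generating_set_def)
  then have "?P (LEAST n. ?P n)" by (rule LeastI_ex)
  then show ?thesis using that unfolding word_norm_def by blast
qed

lemma word_norm_le:
  "set ws \<subseteq> X \<union> set_inv X \<Longrightarrow> foldr (\<otimes>) ws \<one> = g \<Longrightarrow> word_norm G X g \<le> length ws"
  unfolding word_norm_def by (rule Least_le) blast

lemma word_norm_eq_0_iff:
  assumes "generating_set G X" "g \<in> carrier G"
  shows "word_norm G X g = 0 \<longleftrightarrow> g = \<one>"
proof
  assume "word_norm G X g = 0"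
  moreover obtain ws where "length ws = word_norm G X g" "foldr (\<otimes>) ws \<one> = g"
    using word_norm_attained[OF assms] by blast
  ultimately show "g = \<one>" by simp
next
  assume "g = \<one>"
  then show "word_norm G X g = 0" using word_norm_le[of "[]" X g] by simp
qed

lemma word_norm_inv_le:
  assumes "generating_set G X" "g \<in> carrier G"
  shows "word_norm G X (inv g) \<le> word_norm G X g"
proof -
  obtain ws where ws: "set ws \<subseteq> X \<union> set_inv X" "length ws = word_norm G X g"
    "foldr (\<otimes>) ws \<one> = g" by (rule word_norm_attained[OF assms])
  have X: "X \<subseteq> carrier G" using assms by (simp add: generating_set_def)
  have "foldr (\<otimes>) (rev (map (m_inv G) ws)) \<one> = inv g"
    using foldr_mult_rev_inv[of ws] ws set_inv_carrier[OF X] by auto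
  moreover have "set (rev (map (m_inv G) ws)) \<subseteq> X \<union> set_inv X"
    using ws(1) set_inv_closed[OF X] by auto
  ultimately show ?thesis using word_norm_le[of "rev (map (m_inv G) ws)" X "inv g"] ws(2) by simp
qed

lemma word_norm_mult_le:
  assumes "generating_set G X" "g \<in> carrier G" "h \<in> carrier G"
  shows "word_norm G X (g \<otimes> h) \<le> word_norm G X g + word_norm G X h"
proof -
  obtain us where us: "set us \<subseteq> X \<union> set_inv X" "length us = word_norm G X g"
    "foldr (\<otimes>) us \<one> = g" by (rule word_norm_attained[OF assms(1,2)])
  obtain vs where vs: "set vs \<subseteq> X \<union> set_inv X" "length vs = word_norm G X h"
    "foldr (\<otimes>) vs \<one> = h" by (rule word_norm_attained[OF assms(1,3)])
  have X: "X \<subseteq> carrier G" using assms by (simp add: generating_set_def)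
  have "set us \<subseteq> carrier G" "set vs \<subseteq> carrier G"
    using us vs set_inv_carrier[OF X] by auto
  then have "foldr (\<otimes>) (us @ vs) \<one> = g \<otimes> h"
    using foldr_mult_append[of us vs] us(3) vs(3) by metis
  moreover have "set (us @ vs) \<subseteq> X \<union> set_inv X" using us(1) vs(1) by simp
  ultimately show ?thesis using word_norm_le[of "us @ vs" X "g \<otimes> h"] us(2) vs(2) by simp
qed

lemma Metric_space_word_dist:
  assumes "generating_set G X"
  shows "Metric_space (carrier G) (word_dist G X)"
proof
  fix x y
  have le: "word_norm G X (inv x \<otimes> y) \<le> word_norm G X (inv y \<otimes> x)"
    if "x \<in> carrier G" "y \<in> carrier G" for x y
    using word_norm_inv_le[OF assms, of "inv y \<otimes> x"] that by (simp add: inv_mult_group)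
  show "0 \<le> word_dist G X x y" by (simp add: word_dist_def)
  show "word_dist G X x y = word_dist G X y x"
    using le[of x y] le[of y x] by (auto simp: word_dist_def)
  show "word_dist G X x y = 0 \<longleftrightarrow> x = y" if "x \<in> carrier G" "y \<in> carrier G"
  proof -
    have "inv x \<otimes> y = \<one> \<longleftrightarrow> x = y"
      using that inv_solve_left'[of \<one> x y] by auto
    then show ?thesis
      using word_norm_eq_0_iff[OF assms, of "inv x \<otimes> y"] that by (simp add: word_dist_def)
  qed
  show "word_dist G X x z \<le> word_dist G X x y + word_dist G X y z"
    if "x \<in> carrier G" "y \<in> carrier G" "z \<in> carrier G" for z
  proof -
    have "y \<otimes> (inv y \<otimes> z) = z"
      using that by (simp flip: m_assoc)
    then have "(inv x \<otimes> y) \<otimes> (inv y \<otimes> z) = inv x \<otimes> z"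
      using that by (simp add: m_assoc)
    then have "word_norm G X (inv x \<otimes> z)
        \<le> word_norm G X (inv x \<otimes> y) + word_norm G X (inv y \<otimes> z)"
      using word_norm_mult_le[OF assms, of "inv x \<otimes> y" "inv y \<otimes> z"] that by simp
    then show ?thesis using that by (simp add: word_dist_def)
  qed
qed

lemma mspace_word_metric: "generating_set G X \<Longrightarrow> mspace (word_metric G X) = carrier G"
  and mdist_word_metric: "generating_set G X \<Longrightarrow> mdist (word_metric G X) = word_dist G X"
  by (simp_all add: word_metric_def Metric_space_word_dist
      Metric_space.mspace_metric Metric_space.mdist_metric)

end

definition gromov_product :: "'a metric \<Rightarrow> 'a \<Rightarrow> 'a \<Rightarrow> 'a \<Rightarrow> real" where
  "gromov_product M w x y = (mdist M w x + mdist M w y - mdist M x y) / 2"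

definition gromov_hyperbolic :: "'a metric \<Rightarrow> bool" where
  "gromov_hyperbolic M \<longleftrightarrow>
     (\<exists>\<delta>\<ge>0. \<forall>w\<in>mspace M. \<forall>x\<in>mspace M. \<forall>y\<in>mspace M. \<forall>z\<in>mspace M.
        gromov_product M w x z
          \<ge> min (gromov_product M w x y) (gromov_product M w y z) - \<delta>)"

definition hyperbolic_structure :: "('a, 'c) monoid_scheme \<Rightarrow> 'a set \<Rightarrow> bool" where
  "hyperbolic_structure G X \<longleftrightarrow> generating_set G X \<and> gromov_hyperbolic (word_metric G X)"

text \<open>\<^const>\<open>word_metric\<close> is the graph metric on the vertices of
  the Cayley graph, so its diameter is the diameter of the Cayley graph.\<close>

definition ediameter :: "'a metric \<Rightarrow> ereal" where
  "ediameter M = (SUP x\<in>mspace M. SUP y\<in>mspace M. ereal (mdist M x y))"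

definition gen_le :: "('a, 'c) monoid_scheme \<Rightarrow> 'a set \<Rightarrow> 'a set \<Rightarrow> bool" where
  "gen_le G X Y \<longleftrightarrow> Lipschitz_continuous_map (word_metric G Y) (word_metric G X) id"

definition gen_equiv :: "('a, 'c) monoid_scheme \<Rightarrow> 'a set \<Rightarrow> 'a set \<Rightarrow> bool" where
  "gen_equiv G X Y \<longleftrightarrow> gen_le G X Y \<and> gen_le G Y X"


datatype gen = GenA | GenB

primrec alt_word :: "'a \<Rightarrow> 'a \<Rightarrow> nat \<Rightarrow> 'a list" where
  "alt_word x y 0 = []"
| "alt_word x y (Suc n) = x # alt_word y x n"

definition pos_word :: "'g list \<Rightarrow> 'g sword" where
  "pos_word w = map (\<lambda>x. (x, True)) w"

definition dihedral_relations :: "nat \<Rightarrow> (gen sword \<times> gen sword) set" where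
  "dihedral_relations m = {(pos_word (alt_word GenA GenB m), pos_word (alt_word GenB GenA m))}"

text \<open>The parameter \<open>m\<close> is the length of the two sides of the braid relation, so the underlying
  Coxeter group is dihedral of order \<open>2m\<close>.\<close>

definition artin :: "nat \<Rightarrow> gen sword set monoid" where
  "artin m = presented_group (dihedral_relations m)"

definition artin_gen :: "nat \<Rightarrow> gen \<Rightarrow> gen sword set" where
  "artin_gen m x = pres_class (dihedral_relations m) (pos_word [x])"

definition std_gens :: "nat \<Rightarrow> gen sword set set" where
  "std_gens m = {artin_gen m GenA, artin_gen m GenB}"

definition garside :: "nat \<Rightarrow> gen sword set" where
  "garside m = pres_class (dihedral_relations m) (pos_word (alt_word GenA GenB m))"

inductive_set monoid_generate :: "('a, 'c) monoid_scheme \<Rightarrow> 'a set \<Rightarrow> 'a set" for G S where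
  one: "\<one>\<^bsub>G\<^esub> \<in> monoid_generate G S"
| incl: "s \<in> S \<Longrightarrow> s \<in> monoid_generate G S"
| mult: "x \<in> monoid_generate G S \<Longrightarrow> y \<in> monoid_generate G S \<Longrightarrow>
    x \<otimes>\<^bsub>G\<^esub> y \<in> monoid_generate G S"

definition artin_pos :: "nat \<Rightarrow> gen sword set set" where
  "artin_pos m = monoid_generate (artin m) (std_gens m)"

definition artin_inf :: "nat \<Rightarrow> gen sword set \<Rightarrow> int" where
  "artin_inf m x =
     (GREATEST k. garside m [^]\<^bsub>artin m\<^esub> (- k) \<otimes>\<^bsub>artin m\<^esub> x \<in> artin_pos m)"

definition artin_sup :: "nat \<Rightarrow> gen sword set \<Rightarrow> int" where
  "artin_sup m x =
     (LEAST k. inv\<^bsub>artin m\<^esub> x \<otimes>\<^bsub>artin m\<^esub> (garside m [^]\<^bsub>artin m\<^esub> k) \<in> artin_pos m)"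

definition absorbable :: "nat \<Rightarrow> gen sword set \<Rightarrow> bool" where
  "absorbable m y \<longleftrightarrow>
     y \<in> carrier (artin m) \<and> (artin_inf m y = 0 \<or> artin_sup m y = 0) \<and>
     (\<exists>x\<in>carrier (artin m).
        artin_inf m (x \<otimes>\<^bsub>artin m\<^esub> y) = artin_inf m x \<and>
        artin_sup m (x \<otimes>\<^bsub>artin m\<^esub> y) = artin_sup m x)"

definition garside_sq_subgroup :: "nat \<Rightarrow> gen sword set set" where
  "garside_sq_subgroup m = generate (artin m) {garside m [^]\<^bsub>artin m\<^esub> (2::nat)}"

definition X_P :: "nat \<Rightarrow> gen sword set set" where
  "X_P m = generate (artin m) {artin_gen m GenA} \<union> generate (artin m) {artin_gen m GenB}
     \<union> garside_sq_subgroup m"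

definition X_NP :: "nat \<Rightarrow> gen sword set set" where
  "X_NP m = normalizer (artin m) (generate (artin m) {artin_gen m GenA})
     \<union> normalizer (artin m) (generate (artin m) {artin_gen m GenB})"

definition X_abs :: "nat \<Rightarrow> gen sword set set" where
  "X_abs m = {y. absorbable m y} \<union> garside_sq_subgroup m"

end

theory Submission
  imports Defs "HOL-Library.Sublist"
begin

text \<open>
  The group acts simply transitively on Garside normal forms. Modulo \<open>\<Delta>\<close> a normal form is a sequence of
  lengths of alternating words, and multiplication by a generator changes only the last entry, or
  appends or deletes one. So the sequences form a tree of \<open>m\<close>-cycles, and a path from the identity to \<open>g\<close>
  must pass through all prefixes of the sequence of \<open>g\<close>. These bottlenecks make all four word metrics
  hyperbolic at once. The length of the sequence is Lipschitz for the generating set \<open>S \<union> \<langle>\<Delta>\<^sup>2\<rangle>\<close> but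
  unbounded on powers of a generator. The number of changes between adjacent entries is Lipschitz even
  for \<open>X\<^sub>P\<close>, since powers of a generator append and delete constant sequences. An element absorbed without
  a change of infimum and supremum can only lengthen the last factor, so it is short. Finally, an element
  commuting with a generator \<open>c\<close> is a power of \<open>c\<close> times a power of \<open>\<Delta>\<close>, which bounds the normalizers.
\<close>

section \<open>Hyperbolicity of word metrics\<close>

text \<open>Generators in \<open>X_P\<close> and \<open>X_NP\<close> can be arbitrarily long in the
  letters, so a path in their Cayley graphs may jump over a bottleneck. Each generator is therefore
  replaced by a path of small steps, that is, letters and powers of \<open>\<Delta>\<^sup>2\<close>,
  whose vertices stay at bounded distance in the metric under study: the prefixes of a power of
  \<open>c\<close> are again powers of \<open>c\<close>. Bottlenecks are thus needed for small steps
  only, and small steps are bounded in all four metrics. No rewriting of words is needed for the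
  normal forms: the braid relation is checked on states, where both of its sides only raise the
  exponent of \<Delta>, and the normal form of an element is the orbit point of a base state. The
  bound \<open>m \<ge> 3\<close> provides factors of two different positive lengths, 1 and 2, hence
  sequences with many changes. For \<open>m = 2\<close> the group is free abelian of rank 2, and
  every element is a product of two elements of \<open>X_P\<close>.\<close>

lemma gromov_product_change_base:
  assumes "p \<in> mspace M" "q \<in> mspace M" "x \<in> mspace M" "y \<in> mspace M"
  shows "gromov_product M q x y \<le> gromov_product M p x y + mdist M p q"
  using mdist_triangle[of q M p x] mdist_triangle[of q M p y] assms
  by (simp add: gromov_product_def mdist_commute field_simps)

text \<open>The Gromov product at \<open>p\<close> is the defect of \<open>p\<close> from lying
  between two points, so \<open>thin x z p\<close> says that \<open>p\<close> is close to one of the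
  other two sides of every triangle over \<open>x\<close> and \<open>z\<close>. A chain of such
  points replaces a geodesic, and its length does not matter. For given \<open>w\<close> the chain
  yields a coarse median \<open>q\<close> of \<open>x\<close>, \<open>z\<close>, \<open>w\<close>;
  its distance to \<open>w\<close> bounds the left side of the four-point inequality from below and
  the right side from above.\<close>

lemma gromov_hyperbolic_if_thin_paths:
  fixes M :: "'a metric" and C :: real
  defines "thin \<equiv> \<lambda>x z p. p \<in> mspace M \<and>
      (\<forall>y\<in>mspace M. gromov_product M p x y \<le> C \<or> gromov_product M p y z \<le> C)"
  assumes path: "\<And>x z. x \<in> mspace M \<Longrightarrow> z \<in> mspace M \<Longrightarrow>
      (\<lambda>p q. thin x z p \<and> thin x z q \<and> mdist M p q \<le> C)\<^sup>*\<^sup>* x z"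
    and C: "C \<ge> 0"
  shows "gromov_hyperbolic M"
  unfolding gromov_hyperbolic_def
\<comment> \<open>The median costs \<open>4 * C\<close>, from two products of at most
  \<open>2 * C\<close>; thinness of \<open>q\<close> towards \<open>y\<close> costs another
  \<open>C\<close>.\<close>
proof (intro exI[of _ "5 * C"] conjI ballI)
  show "0 \<le> 5 * C" using C by simp
next
  fix w x y z assume in_M: "w \<in> mspace M" "x \<in> mspace M" "y \<in> mspace M" "z \<in> mspace M"
  let ?R = "\<lambda>p q. thin x z p \<and> thin x z q \<and> mdist M p q \<le> C"
  \<comment> \<open>A path from \<open>x\<close> to \<open>z\<close> must leave the set of points close to the side from \<open>x\<close> to \<open>w\<close>;
    where it does so, there is a coarse median of \<open>x\<close>, \<open>z\<close>, \<open>w\<close>.\<close>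
  have "\<exists>q. (thin x z q \<or> q = x) \<and> gromov_product M q x w \<le> 2 * C \<and> gromov_product M q w z \<le> 2 * C"
  proof (cases "x = z")
    case True
    have "mdist M x x = 0" using in_M by simp
    then show ?thesis using True C by (intro exI[of _ x]) (simp add: gromov_product_def mdist_commute)
  next
    case False
    have "(?R\<^sup>*\<^sup>* x v \<Longrightarrow> (\<exists>q. thin x z q \<and> gromov_product M q x w \<le> 2 * C \<and> gromov_product M q w z \<le> 2 * C)
        \<or> gromov_product M v x w \<le> C)" for v
    proof (induction rule: rtranclp_induct)
      case base
      have "mdist M x x = 0" using in_M by simp
      then show ?case using C by (simp add: gromov_product_def mdist_commute)
    next
      case (step p q)
      show ?case
      proof (cases "gromov_product M q x w \<le> C")
        case False
        have pq: "p \<in> mspace M" "q \<in> mspace M" "mdist M p q \<le> C" "thin x z q"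
          using step by (auto simp: thin_def)
        then have "gromov_product M q w z \<le> C" using False in_M by (auto simp: thin_def)
        \<comment> \<open>The product is known to be small at \<open>p\<close> only, and the step
          from \<open>p\<close> to \<open>q\<close> adds at most \<open>C\<close>.\<close>
        moreover have "gromov_product M q x w \<le> 2 * C" if "gromov_product M p x w \<le> C"
          using gromov_product_change_base[of p M q x w] pq in_M that by simp
        ultimately show ?thesis using step.IH pq(4) C by force
      qed simp
    qed
    from this[of z] path[OF in_M(2,4)] consider
        "\<exists>q. thin x z q \<and> gromov_product M q x w \<le> 2 * C \<and> gromov_product M q w z \<le> 2 * C"
      | "gromov_product M z x w \<le> C" by blast
    then show ?thesis
    proof cases
      case 2
      \<comment> \<open>As \<open>x\<close> differs from \<open>z\<close>, the chain has a last
        step, and this makes its endpoint \<open>z\<close> thin.\<close>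
      have "thin x z z"
        using path[OF in_M(2,4)] False by (cases rule: rtranclp.cases) auto
      moreover have "mdist M z z = 0" using in_M by simp
      ultimately show ?thesis using 2 C
        by (intro exI[of _ z]) (simp add: gromov_product_def mdist_commute)
    qed auto
  qed
  then obtain q where q: "thin x z q \<or> q = x"
    "gromov_product M q x w \<le> 2 * C" "gromov_product M q w z \<le> 2 * C" by blast
  have qM: "q \<in> mspace M" using q(1) in_M by (auto simp: thin_def)
  have "mdist M x z \<le> mdist M q x + mdist M q z"
    using mdist_triangle[of x M q z] in_M qM by (simp add: mdist_commute)
  then have below: "gromov_product M w x z \<ge> mdist M q w - 4 * C"
    using q(2,3) by (simp add: gromov_product_def mdist_commute field_simps)
  have "gromov_product M q x y \<le> C \<or> gromov_product M q y z \<le> C"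
  proof (cases "q = x")
    case True
    moreover have "mdist M x x = 0" using in_M by simp
    ultimately show ?thesis using C by (simp add: gromov_product_def mdist_commute)
  qed (use q(1) in_M in \<open>auto simp: thin_def\<close>)
  then have "gromov_product M w x y \<le> C + mdist M q w \<or> gromov_product M w y z \<le> C + mdist M q w"
    using gromov_product_change_base[of q M w x y] gromov_product_change_base[of q M w y z] in_M qM
    by force
  then show "gromov_product M w x z
      \<ge> min (gromov_product M w x y) (gromov_product M w y z) - 5 * C"
    using below by linarith
qed

context group
begin

lemma word_dist_eq:
  "x \<in> carrier G \<Longrightarrow> y \<in> carrier G \<Longrightarrow> word_dist G X x y = real (word_norm G X (inv x \<otimes> y))"
  by (simp add: word_dist_def)

lemma word_norm_foldr_le:
  assumes "generating_set G X" "set ws \<subseteq> carrier G" "\<And>w. w \<in> set ws \<Longrightarrow> word_norm G X w \<le> C"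
  shows "word_norm G X (foldr (\<otimes>) ws \<one>) \<le> C * length ws"
  using assms(2,3)
proof (induction ws)
  case Nil
  then show ?case using word_norm_le[of "[]" X \<one>] by simp
next
  case (Cons w ws)
  have "word_norm G X (w \<otimes> foldr (\<otimes>) ws \<one>) \<le> word_norm G X w + word_norm G X (foldr (\<otimes>) ws \<one>)"
    using Cons.prems by (intro word_norm_mult_le assms(1) foldr_mult_closed) auto
  moreover have "word_norm G X w \<le> C" "word_norm G X (foldr (\<otimes>) ws \<one>) \<le> C * length ws"
    using Cons by auto
  ultimately show ?case by simp
qed

lemma word_norm_inv:
  assumes "generating_set G X" "g \<in> carrier G"
  shows "word_norm G X (inv g) = word_norm G X g"
  using word_norm_inv_le[OF assms] word_norm_inv_le[of X "inv g"] assms by simp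

lemma word_norm_one [simp]: "word_norm G X \<one> = 0"
  using word_norm_le[of "[]" X \<one>] by simp

lemma word_norm_gen_le_1:
  assumes "X \<subseteq> carrier G" "g \<in> X \<union> set_inv X"
  shows "word_norm G X g \<le> 1"
proof -
  have "g \<in> carrier G" using assms set_inv_carrier by blast
  then show ?thesis using word_norm_le[of "[g]" X g] assms(2) by simp
qed

lemma word_norm_le_if_gens_le:
  assumes X: "generating_set G X" and Y: "generating_set G Y"
    and bound: "\<And>y. y \<in> Y \<Longrightarrow> word_norm G X y \<le> C" and g: "g \<in> carrier G"
  shows "word_norm G X g \<le> C * word_norm G Y g"
proof -
  obtain ws where ws: "set ws \<subseteq> Y \<union> set_inv Y" "length ws = word_norm G Y g"
    "foldr (\<otimes>) ws \<one> = g" by (rule word_norm_attained[OF Y g])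
  have Yc: "Y \<subseteq> carrier G" using Y by (simp add: generating_set_def)
  have "word_norm G X w \<le> C" if "w \<in> Y \<union> set_inv Y" for w
    using that bound word_norm_inv[OF X] Yc by (auto simp: SET_INV_def)
  then show ?thesis
    using word_norm_foldr_le[OF X, of ws C] ws set_inv_carrier[OF Yc] by auto
qed

lemma gen_le_iff:
  assumes X: "generating_set G X" and Y: "generating_set G Y"
  shows "gen_le G X Y \<longleftrightarrow> (\<exists>C. \<forall>y\<in>Y. word_norm G X y \<le> C)"
proof
  assume "gen_le G X Y"
  then obtain B where B: "\<forall>x\<in>carrier G. \<forall>y\<in>carrier G. word_dist G X x y \<le> B * word_dist G Y x y"
    by (auto simp: gen_le_def Lipschitz_continuous_map_def mspace_word_metric mdist_word_metric X Y)
  have "word_norm G X y \<le> nat \<lceil>\<bar>B\<bar>\<rceil>" if "y \<in> Y" for y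
  proof -
    have y: "y \<in> carrier G" using that Y by (auto simp: generating_set_def)
    have "real (word_norm G X y) \<le> B * real (word_norm G Y y)"
      using B[rule_format, of \<one> y] y by (simp add: word_dist_eq)
    also have "\<dots> \<le> \<bar>B\<bar> * 1"
      using word_norm_gen_le_1[of Y y] that Y by (intro mult_mono) (auto simp: generating_set_def)
    finally show ?thesis by linarith
  qed
  then show "\<exists>C. \<forall>y\<in>Y. word_norm G X y \<le> C" by blast
next
  assume "\<exists>C. \<forall>y\<in>Y. word_norm G X y \<le> C"
  then obtain C where C: "\<And>y. y \<in> Y \<Longrightarrow> word_norm G X y \<le> C" by blast
  have "word_dist G X x y \<le> real C * word_dist G Y x y" if "x \<in> carrier G" "y \<in> carrier G" for x y
    using word_norm_le_if_gens_le[OF X Y C, of "inv x \<otimes> y"] that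
    by (simp add: word_dist_eq flip: of_nat_mult)
  then show "gen_le G X Y"
    by (auto simp: gen_le_def Lipschitz_continuous_map_def mspace_word_metric mdist_word_metric X Y)
qed

lemma gen_le_trans: "gen_le G X Y \<Longrightarrow> gen_le G Y Z \<Longrightarrow> gen_le G X Z"
  unfolding gen_le_def using Lipschitz_continuous_map_compose[of _ _ id _ id] by fastforce

section \<open>Refinement of paths and the bottleneck criterion\<close>

lemma take_append_foldr:
  assumes "set ws \<subseteq> carrier G"
  shows "foldr (\<otimes>) ws \<one> = foldr (\<otimes>) (take i ws) \<one> \<otimes> foldr (\<otimes>) (drop i ws) \<one>"
  using foldr_mult_append[of "take i ws" "drop i ws"] assms set_take_subset[of i ws] set_drop_subset[of i ws]
  by fastforce

text \<open>Bottlenecks are assumed for \<open>Y\<close>-paths, while geodesics are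
  \<open>X\<close>-paths. Replacing each \<open>X\<close>-letter by a \<open>Y\<close>-word that
  stays within \<open>C\<close> of its start gives a \<open>Y\<close>-path every vertex of which is
  within \<open>C\<close> of a vertex of the given path.\<close>

lemma refine_word:
  assumes X: "generating_set G X" and Y: "Y \<subseteq> carrier G"
    and refine: "\<And>s. s \<in> X \<union> set_inv X \<Longrightarrow> \<exists>ws. set ws \<subseteq> Y \<and> foldr (\<otimes>) ws \<one> = s \<and>
        (\<forall>i. word_norm G X (foldr (\<otimes>) (take i ws) \<one>) \<le> C)"
    and us: "set us \<subseteq> X \<union> set_inv X"
  shows "\<exists>ws. set ws \<subseteq> Y \<and> foldr (\<otimes>) ws \<one> = foldr (\<otimes>) us \<one> \<and>
     (\<forall>i. \<exists>j\<le>length us. \<exists>r\<in>carrier G. foldr (\<otimes>) (take i ws) \<one> = foldr (\<otimes>) (take j us) \<one> \<otimes> r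
        \<and> word_norm G X r \<le> C)"
  using us
proof (induction us)
  case Nil
  then show ?case by (intro exI[of _ "[]"]) auto
next
  case (Cons s us)
  from Cons obtain ws where ws: "set ws \<subseteq> Y" "foldr (\<otimes>) ws \<one> = foldr (\<otimes>) us \<one>"
     "\<forall>i. \<exists>j\<le>length us. \<exists>r\<in>carrier G. foldr (\<otimes>) (take i ws) \<one> = foldr (\<otimes>) (take j us) \<one> \<otimes> r
        \<and> word_norm G X r \<le> C" by auto
  obtain vs where vs: "set vs \<subseteq> Y" "foldr (\<otimes>) vs \<one> = s"
     "\<forall>i. word_norm G X (foldr (\<otimes>) (take i vs) \<one>) \<le> C"
    using refine[of s] Cons.prems by auto
  have Xc: "X \<union> set_inv X \<subseteq> carrier G" using X set_inv_carrier by (simp add: generating_set_def)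
  have carr: "set vs \<subseteq> carrier G" "set ws \<subseteq> carrier G" "s \<in> carrier G" "set us \<subseteq> carrier G"
    using ws vs Y Xc Cons.prems by auto
  have "\<exists>j\<le>length (s # us). \<exists>r\<in>carrier G.
      foldr (\<otimes>) (take i (vs @ ws)) \<one> = foldr (\<otimes>) (take j (s # us)) \<one> \<otimes> r \<and> word_norm G X r \<le> C" for i
  proof (cases "i \<le> length vs")
    case True
    have "set (take i vs) \<subseteq> carrier G" using carr(1) set_take_subset[of i vs] by blast
    then show ?thesis using True vs(3)
      by (intro exI[of _ 0]) (auto simp: foldr_mult_closed intro!: bexI[of _ "foldr (\<otimes>) (take i vs) \<one>"])
  next
    case False
    obtain j r where jr: "j \<le> length us" "r \<in> carrier G"
      "foldr (\<otimes>) (take (i - length vs) ws) \<one> = foldr (\<otimes>) (take j us) \<one> \<otimes> r" "word_norm G X r \<le> C"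
      using ws(3) by meson
    have tc: "set (take (i - length vs) ws) \<subseteq> carrier G" "set (take j us) \<subseteq> carrier G"
      using carr set_take_subset by (metis subset_trans)+
    have "foldr (\<otimes>) (take i (vs @ ws)) \<one> = s \<otimes> (foldr (\<otimes>) (take j us) \<one> \<otimes> r)"
      using False foldr_mult_append[OF carr(1) tc(1)] vs(2) jr(3) by simp
    also have "\<dots> = foldr (\<otimes>) (take (Suc j) (s # us)) \<one> \<otimes> r"
      using carr jr tc by (simp add: m_assoc foldr_mult_closed)
    finally show ?thesis using jr by (intro exI[of _ "Suc j"]) auto
  qed
  moreover have "foldr (\<otimes>) (vs @ ws) \<one> = foldr (\<otimes>) (s # us) \<one>"
    using foldr_mult_append[OF carr(1,2)] vs ws by simp
  ultimately show ?case using vs ws by (intro exI[of _ "vs @ ws"]) auto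
qed

lemma word_norm_geodesic:
  assumes X: "generating_set G X" and us: "set us \<subseteq> X \<union> set_inv X"
    "length us = word_norm G X (foldr (\<otimes>) us \<one>)"
  shows "word_norm G X (foldr (\<otimes>) (take j us) \<one>) + word_norm G X (foldr (\<otimes>) (drop j us) \<one>)
     \<le> word_norm G X (foldr (\<otimes>) us \<one>)"
proof -
  have "word_norm G X (foldr (\<otimes>) (take j us) \<one>) \<le> length (take j us)"
    "word_norm G X (foldr (\<otimes>) (drop j us) \<one>) \<le> length (drop j us)"
    using us(1) set_take_subset[of j us] set_drop_subset[of j us]
    by (intro word_norm_le; auto)+
  then show ?thesis using us(2) by (simp add: min_def split: if_splits)
qed

text \<open>A coarse form of Manning's bottleneck criterion for quasi-trees. It is stated for paths with steps
  in an auxiliary set \<open>Y\<close>, so that one set of bottlenecks serves several generating sets.\<close>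

lemma hyperbolic_structure_if_bottleneck:
  fixes C :: nat
  defines "near \<equiv> \<lambda>X Y g p. p \<in> carrier G \<and> (\<forall>ws. set ws \<subseteq> Y \<longrightarrow> foldr (\<otimes>) ws \<one> = g \<longrightarrow>
      (\<exists>i. word_norm G X (inv (foldr (\<otimes>) (take i ws) \<one>) \<otimes> p) \<le> C))"
  assumes X: "generating_set G X" and Y: "Y \<subseteq> carrier G"
    and refine: "\<And>s. s \<in> X \<union> set_inv X \<Longrightarrow> \<exists>ws. set ws \<subseteq> Y \<and> foldr (\<otimes>) ws \<one> = s \<and>
        (\<forall>i. word_norm G X (foldr (\<otimes>) (take i ws) \<one>) \<le> C)"
    and path: "\<And>g. g \<in> carrier G \<Longrightarrow>
       (\<lambda>p q. near X Y g p \<and> near X Y g q \<and> word_norm G X (inv p \<otimes> q) \<le> C)\<^sup>*\<^sup>* \<one> g"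
  shows "hyperbolic_structure G X"
  unfolding hyperbolic_structure_def
\<comment> \<open>One \<open>C\<close> is the distance from a bottleneck to the
  \<open>Y\<close>-path, the other that from the \<open>Y\<close>-path to the path it
  refines.\<close>
proof (intro conjI X gromov_hyperbolic_if_thin_paths[where C = "real (2 * C)"])
  have Xc: "X \<union> set_inv X \<subseteq> carrier G" using X set_inv_carrier by (simp add: generating_set_def)
  let ?M = "word_metric G X"
  let ?thin = "\<lambda>x z p. p \<in> mspace ?M \<and>
      (\<forall>y\<in>mspace ?M. gromov_product ?M p x y \<le> real (2 * C) \<or> gromov_product ?M p y z \<le> real (2 * C))"
  fix x z assume "x \<in> mspace ?M" "z \<in> mspace ?M"
  then have xz: "x \<in> carrier G" "z \<in> carrier G" by (auto simp: mspace_word_metric X)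
  have cancel: "inv (x \<otimes> p) \<otimes> (x \<otimes> q) = inv p \<otimes> q" if "p \<in> carrier G" "q \<in> carrier G" "x \<in> carrier G" for p q x
    using that by (simp add: inv_mult_group m_assoc) (simp flip: m_assoc)
  have dist: "mdist ?M (x \<otimes> p) (x \<otimes> q) = real (word_norm G X (inv p \<otimes> q))"
    if "p \<in> carrier G" "q \<in> carrier G" "x \<in> carrier G" for p q x
    using that by (simp add: mdist_word_metric X word_dist_eq cancel)
  \<comment> \<open>The product vanishes at a vertex of the geodesic and changes by at most the
    distance when the base point moves.\<close>
  have geod: "gromov_product ?M p h (h \<otimes> foldr (\<otimes>) us \<one>) \<le> 2 * C"
    if us: "set us \<subseteq> X \<union> set_inv X" "length us = word_norm G X (foldr (\<otimes>) us \<one>)"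
      and h: "h \<in> carrier G" and p: "p \<in> carrier G"
      and near_p: "word_norm G X (inv (h \<otimes> foldr (\<otimes>) (take j us) \<one>) \<otimes> p) \<le> 2 * C" for p h us j
  proof -
    have usc: "set us \<subseteq> carrier G" "set (take j us) \<subseteq> carrier G" "set (drop j us) \<subseteq> carrier G"
      using us(1) Xc set_take_subset[of j us] set_drop_subset[of j us] by auto
    let ?q = "foldr (\<otimes>) (take j us) \<one>" let ?r = "foldr (\<otimes>) (drop j us) \<one>"
    have c: "?q \<in> carrier G" "?r \<in> carrier G" using usc by (auto intro: foldr_mult_closed)
    have e: "foldr (\<otimes>) us \<one> = ?q \<otimes> ?r" by (rule take_append_foldr[OF usc(1)])
    have "gromov_product ?M (h \<otimes> ?q) h (h \<otimes> foldr (\<otimes>) us \<one>) \<le> 0"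
      using word_norm_geodesic[OF X us, of j] c h dist[of ?q \<one> h] dist[of ?q "?q \<otimes> ?r" h] dist[of \<one> "?q \<otimes> ?r" h]
      by (simp add: gromov_product_def e word_norm_inv[OF X] m_assoc[symmetric])
    moreover have "mdist ?M (h \<otimes> ?q) p \<le> 2 * C"
      using near_p c h p by (simp add: mdist_word_metric X word_dist_eq)
    ultimately show ?thesis
      using gromov_product_change_base[of "h \<otimes> ?q" ?M p h "h \<otimes> foldr (\<otimes>) us \<one>"] c h p usc
      by (simp add: mspace_word_metric X e)
  qed
  have thin: "?thin x z (x \<otimes> p)" if near_p: "near X Y (inv x \<otimes> z) p" for p
  proof (intro conjI ballI)
    have p: "p \<in> carrier G" using near_p by (simp add: near_def)
    then show "x \<otimes> p \<in> mspace ?M" using xz by (simp add: mspace_word_metric X)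
    fix y assume "y \<in> mspace ?M"
    then have y: "y \<in> carrier G" by (simp add: mspace_word_metric X)
    \<comment> \<open>Geodesics from \<open>x\<close> to \<open>y\<close> and from \<open>y\<close>
      to \<open>z\<close> are joined and refined. The resulting path has to come near the
      bottleneck, and the index \<open>j\<close> found below tells on which of the two geodesics
      this happens.\<close>
    obtain us where us: "set us \<subseteq> X \<union> set_inv X" "length us = word_norm G X (inv x \<otimes> y)"
      "foldr (\<otimes>) us \<one> = inv x \<otimes> y" using word_norm_attained[OF X, of "inv x \<otimes> y"] xz y by auto
    obtain vs where vs: "set vs \<subseteq> X \<union> set_inv X" "length vs = word_norm G X (inv y \<otimes> z)"
      "foldr (\<otimes>) vs \<one> = inv y \<otimes> z" using word_norm_attained[OF X, of "inv y \<otimes> z"] xz y by auto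
    have c: "set us \<subseteq> carrier G" "set vs \<subseteq> carrier G" using us vs Xc by auto
    have uv: "foldr (\<otimes>) (us @ vs) \<one> = inv x \<otimes> z"
      using foldr_mult_append[OF c] us vs xz y by (simp add: m_assoc) (simp flip: m_assoc)
    obtain ws where ws: "set ws \<subseteq> Y" "foldr (\<otimes>) ws \<one> = inv x \<otimes> z"
      "\<forall>i. \<exists>j\<le>length (us @ vs). \<exists>r\<in>carrier G. foldr (\<otimes>) (take i ws) \<one> = foldr (\<otimes>) (take j (us @ vs)) \<one> \<otimes> r
        \<and> word_norm G X r \<le> C"
      using refine_word[OF X Y refine, of "us @ vs"] us vs uv by auto
    obtain i where i: "word_norm G X (inv (foldr (\<otimes>) (take i ws) \<one>) \<otimes> p) \<le> C"
      using near_p ws(1,2) by (auto simp: near_def)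
    obtain j r where jr: "r \<in> carrier G" "word_norm G X r \<le> C"
      "foldr (\<otimes>) (take i ws) \<one> = foldr (\<otimes>) (take j (us @ vs)) \<one> \<otimes> r" using ws(3) by blast
    let ?q = "foldr (\<otimes>) (take j (us @ vs)) \<one>"
    have "set (take j (us @ vs)) \<subseteq> carrier G" using c set_take_subset[of j "us @ vs"] by auto
    then have q: "?q \<in> carrier G" by (rule foldr_mult_closed)
    have "inv ?q \<otimes> p = r \<otimes> (inv (?q \<otimes> r) \<otimes> p)"
      using q jr(1) p by (simp add: inv_mult_group m_assoc[symmetric])
    then have qp: "word_norm G X (inv ?q \<otimes> p) \<le> 2 * C"
      using word_norm_mult_le[OF X, of r "inv (?q \<otimes> r) \<otimes> p"] jr i q p by simp
    show "gromov_product ?M (x \<otimes> p) x y \<le> real (2 * C) \<or> gromov_product ?M (x \<otimes> p) y z \<le> real (2 * C)"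
    proof (cases "j \<le> length us")
      case True
      have "gromov_product ?M (x \<otimes> p) x (x \<otimes> foldr (\<otimes>) us \<one>) \<le> 2 * C"
        using True us vs xz y p q qp by (intro geod[of us _ _ j]) (auto simp: cancel)
      then show ?thesis using us xz y by (simp flip: m_assoc)
    next
      case False
      let ?k = "j - length us"
      have tc: "set (take ?k vs) \<subseteq> carrier G" using c(2) set_take_subset[of ?k vs] by blast
      have "?q = (inv x \<otimes> y) \<otimes> foldr (\<otimes>) (take ?k vs) \<one>"
        using False foldr_mult_append[OF c(1) tc] us(3) by simp
      then have "y \<otimes> foldr (\<otimes>) (take ?k vs) \<one> = x \<otimes> ?q"
        using xz y foldr_mult_closed[OF tc] by (simp flip: m_assoc)
      then have "gromov_product ?M (x \<otimes> p) y (y \<otimes> foldr (\<otimes>) vs \<one>) \<le> 2 * C"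
        using us vs xz y p q qp by (intro geod[of vs _ _ ?k]) (auto simp: cancel)
      then show ?thesis using vs xz y by (simp flip: m_assoc)
    qed
  qed
  have "(\<lambda>p q. ?thin x z p \<and> ?thin x z q \<and> mdist ?M p q \<le> real (2 * C))\<^sup>*\<^sup>* (x \<otimes> \<one>) (x \<otimes> v)"
    if "(\<lambda>p q. near X Y (inv x \<otimes> z) p \<and> near X Y (inv x \<otimes> z) q \<and> word_norm G X (inv p \<otimes> q) \<le> C)\<^sup>*\<^sup>* \<one> v" for v
    using that
  proof (induction rule: rtranclp_induct)
    case (step p q)
    have "mdist ?M (x \<otimes> p) (x \<otimes> q) \<le> real (2 * C)"
      using step xz by (subst dist) (auto simp: near_def)
    then show ?case using step thin by (intro rtranclp.rtrancl_into_rtrancl[OF step.IH]) auto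
  qed simp
  from this[OF path] show "(\<lambda>p q. ?thin x z p \<and> ?thin x z q \<and> mdist ?M p q \<le> real (2 * C))\<^sup>*\<^sup>* x z"
    using xz by (simp add: m_assoc[symmetric])
qed simp

lemma ediameter_word_metric_infinite:
  assumes X: "generating_set G X" and unbounded: "\<And>n. \<exists>g\<in>carrier G. word_norm G X g \<ge> n"
  shows "ediameter (word_metric G X) = \<infinity>"
proof -
  have "ereal (real n) \<le> ediameter (word_metric G X)" for n
  proof -
    obtain g where g: "g \<in> carrier G" "word_norm G X g \<ge> n" using unbounded by blast
    have "ereal (real n) \<le> ereal (mdist (word_metric G X) \<one> g)"
      using g by (simp add: mdist_word_metric X word_dist_eq)
    also have "\<dots> \<le> ediameter (word_metric G X)"
      unfolding ediameter_def using g(1) by (intro SUP_upper2[of \<one>] SUP_upper) (auto simp: mspace_word_metric X)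
    finally show ?thesis .
  qed
  then show ?thesis
    by (metis less_PInf_Ex_of_nat linorder_not_less order_le_less)
qed

end


section \<open>States and the action of the generators\<close>

fun flip :: "gen \<Rightarrow> gen" where
  "flip GenA = GenB"
| "flip GenB = GenA"

lemma flip_flip [simp]: "flip (flip c) = c"
  by (cases c) auto

lemma flip_neq [simp]: "flip c \<noteq> c" "c \<noteq> flip c"
  by (cases c; simp)+

lemma neq_iff_eq_flip: "c \<noteq> d \<longleftrightarrow> c = flip d"
  by (cases c; cases d) auto

lemma alt_word_snoc: "alt_word x y (Suc n) = alt_word x y n @ [if even n then x else y]"
  by (induction n arbitrary: x y) auto

lemma length_alt_word [simp]: "length (alt_word x y n) = n"
  by (induction n arbitrary: x y) auto

text \<open>A state \<open>(w, p)\<close> encodes the element \<open>x\<^sub>0 x\<^sub>1 \<dots> x\<^sub>r \<Delta>\<^sup>p\<close> in Garside normal form, where \<open>w\<close> lists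
  the lengths of \<open>x\<^sub>r, \<dots>, x\<^sub>0\<close>. Each \<open>x\<^sub>i\<close> is an alternating word whose first letter is the last letter
  of its predecessor. To have this also for \<open>x\<^sub>0\<close>, it always starts with \<open>GenB\<close>, and may be empty.\<close>

type_synonym state = "nat list \<times> int"

fun valid_lengths :: "nat \<Rightarrow> nat list \<Rightarrow> bool" where
  "valid_lengths m [] \<longleftrightarrow> False"
| "valid_lengths m (l # u) \<longleftrightarrow> l < m \<and> (u \<noteq> [] \<longrightarrow> 0 < l \<and> valid_lengths m u)"

definition states :: "nat \<Rightarrow> state set" where
  "states m = {n. valid_lengths m (fst n)}"

text \<open>The generator that starts a new factor: the last letter of the last factor, seen through \<open>\<Delta>\<^sup>p\<close>.\<close>

definition new_gen :: "nat \<Rightarrow> state \<Rightarrow> gen" where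
  "new_gen m n =
     (if odd (int (sum_list (fst n)) + int (length (fst n)) + int m * snd n) then GenA else GenB)"

text \<open>This is right multiplication by \<open>c\<close>. A repeated letter cannot prolong an
  alternating word, so it opens a factor. A factor that reaches length \<open>m\<close> equals
  \<Delta> and joins the power on the right. The list of a state is never empty: \<open>[0]\<close>
  stands for an empty first factor, and the value at \<open>[]\<close> is a dummy.\<close>

fun step :: "nat \<Rightarrow> gen \<Rightarrow> state \<Rightarrow> state" where
  "step m c ([], p) = ([], p)"
| "step m c (l # u, p) =
     (if c = new_gen m (l # u, p) then (1 # l # u, p)
      else if Suc l < m then (Suc l # u, p)
      else (if u = [] then [0] else u, p + 1))"

lemma states_cases:
  assumes "n \<in> states m"
  obtains l u p where "n = (l # u, p)" "l < m" "u \<noteq> [] \<Longrightarrow> 0 < l \<and> (u, p) \<in> states m"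
proof (cases n)
  case (Pair w p)
  then show ?thesis using assms that by (cases w) (auto simp: states_def)
qed

lemma new_gen_Suc: "new_gen m (Suc l # u, p) = flip (new_gen m (l # u, p))"
  by (auto simp: new_gen_def)

lemma new_gen_push [simp]: "new_gen m (Suc 0 # w, p) = new_gen m (w, p)"
  by (auto simp: new_gen_def)

text \<open>Removing an entry \<open>m - 1\<close> lowers sum plus length by \<open>m\<close>, which
  the higher exponent restores. In \<open>new_gen_wrap\<close> the length stays the same, and the
  parity flips.\<close>

lemma new_gen_drop:
  assumes "Suc l = m"
  shows "new_gen m (u, p + 1) = new_gen m (l # u, p)"
proof -
  have "int m = int l + 1" using assms by simp
  then show ?thesis by (auto simp: new_gen_def algebra_simps)
qed

lemma new_gen_wrap:
  assumes "Suc l = m"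
  shows "new_gen m ([0], p + 1) = flip (new_gen m ([l], p))"
proof -
  have "int m = int l + 1" using assms by simp
  then show ?thesis by (auto simp: new_gen_def algebra_simps)
qed

lemma new_gen_shift: "new_gen m (w, p + q) = (if odd (int m * q) then flip (new_gen m (w, p)) else new_gen m (w, p))"
  by (auto simp: new_gen_def algebra_simps)

lemma step_in_states:
  assumes "m \<ge> 3" "n \<in> states m"
  shows "step m c n \<in> states m"
  using assms(2) by (rule states_cases) (use assms(1) in \<open>auto simp: states_def\<close>)

lemma fold_step_in_states: "m \<ge> 3 \<Longrightarrow> n \<in> states m \<Longrightarrow> fold (step m) cs n \<in> states m"
  by (induction cs arbitrary: n) (auto simp: step_in_states)

lemma fold_step_grow:
  "l + j < m \<Longrightarrow> c \<noteq> new_gen m (l # u, p) \<Longrightarrow>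
   fold (step m) (alt_word c (flip c) j) (l # u, p) = ((l + j) # u, p)"
proof (induction j arbitrary: l c)
  case (Suc j)
  have "fold (step m) (alt_word (flip c) c j) (Suc l # u, p) = ((Suc l + j) # u, p)"
    using Suc.IH[of "Suc l" "flip c"] Suc.prems by (auto simp: new_gen_Suc neq_iff_eq_flip)
  then show ?case using Suc.prems by simp
qed simp

lemma new_gen_grow: "new_gen m ((l + j) # u, p) = (if even j then new_gen m (l # u, p) else flip (new_gen m (l # u, p)))"
  by (induction j) (auto simp: new_gen_Suc)

lemma fold_step_complete:
  assumes "l < m" "c \<noteq> new_gen m (l # u, p)"
  shows "fold (step m) (alt_word c (flip c) (m - l)) (l # u, p) = (if u = [] then [0] else u, p + 1)"
proof -
  define j where "j = m - l - 1"
  have m: "m - l = Suc j" "l + j < m" "Suc (l + j) = m" using assms j_def by auto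
  have "fold (step m) (alt_word c (flip c) j) (l # u, p) = ((l + j) # u, p)"
    using fold_step_grow[OF m(2) assms(2)] .
  then show ?thesis
    using m(3) assms(2) unfolding m(1) alt_word_snoc
    by (auto simp: new_gen_grow neq_iff_eq_flip)
qed

lemma alt_word_add:
  "alt_word x y (i + j) = alt_word x y i @ (if even i then alt_word x y j else alt_word y x j)"
  by (induction i arbitrary: x y) auto

text \<open>If the first letter opens a factor, the word fills this factor up to \<Delta>. Otherwise
  \<open>m - l\<close> letters complete the last factor, and the remaining \<open>l\<close> letters
  rebuild it. The result does not depend on \<open>c\<close>, which is the braid relation on
  states.\<close>

lemma fold_step_garside:
  assumes m: "m \<ge> 3" and n: "(w, p) \<in> states m"
  shows "fold (step m) (alt_word c (flip c) m) (w, p) = (w, p + 1)"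
proof -
  from n obtain l u where w: "w = l # u" "l < m" "u \<noteq> [] \<Longrightarrow> 0 < l \<and> (u, p) \<in> states m"
    by (rule states_cases) auto
  show ?thesis
  proof (cases "c = new_gen m (w, p)")
    case True
    have "alt_word c (flip c) m = c # alt_word (flip c) c (m - 1)"
      using m by (cases m) auto
    moreover have "fold (step m) (alt_word (flip c) c (m - 1)) (1 # w, p) = (w, p + 1)"
      using fold_step_complete[of 1 m "flip c" w p] True m w by auto
    ultimately show ?thesis using True w by simp
  next
    case False
    \<comment> \<open>The letter with which the remaining \<open>l\<close> letters begin.\<close>
    define d where "d = (if even (m - l) then c else flip c)"
    have split: "alt_word c (flip c) m = alt_word c (flip c) (m - l) @ alt_word d (flip d) l"
      using alt_word_add[of c "flip c" "m - l" l] w(2) by (simp add: d_def)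
    have c: "c = flip (new_gen m (l # u, p))" using False w(1) by (simp add: neq_iff_eq_flip)
    have "fold (step m) (alt_word d (flip d) l) (if u = [] then [0] else u, p + 1) = (l # u, p + 1)"
    proof (cases "u = []")
      case True
      have "d \<noteq> new_gen m ([0], p + 1)"
        using c w(2) new_gen_grow[of m 0 l "[]" p] new_gen_shift[of m "[0]" p 1] True
        by (cases "even m"; cases "even l"; cases "new_gen m ([0], p)") (simp_all add: d_def)
      then show ?thesis using fold_step_grow[of 0 l m d "[]" "p + 1"] w(2) True by simp
    next
      case u: False
      then obtain j where j: "l = Suc j" using w(3) by (cases l) auto
      have d: "d = new_gen m (u, p + 1)"
        using c w(2) new_gen_grow[of m 1 j u p] new_gen_shift[of m u p 1] j
        by (cases "even m"; cases "even j"; cases "new_gen m (u, p)") (simp_all add: d_def)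
      obtain h v where u': "u = h # v" using u by (cases u) auto
      have "fold (step m) (alt_word (flip d) d j) (1 # u, p + 1) = (l # u, p + 1)"
        using fold_step_grow[of 1 j m "flip d" u "p + 1"] w(2) j d by auto
      then show ?thesis using d u' j by simp
    qed
    then show ?thesis
      unfolding split using fold_step_complete[of l m c u p] False w by simp
  qed
qed

text \<open>There is a word for \<Delta> that begins with \<open>c\<close> and one that ends with
  \<open>c\<close>. Both act by raising the exponent, which is a bijection, so
  \<open>step m c\<close> is injective and surjective.\<close>

lemma bij_betw_step:
  assumes m: "m \<ge> 3"
  shows "bij_betw (step m c) (states m) (states m)"
proof -
  obtain k where k: "m = Suc k" using m by (cases m) auto
  have left: "fold (step m) (alt_word (flip c) c k) (step m c (w, p)) = (w, p + 1)"
    if "(w, p) \<in> states m" for w p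
    using fold_step_garside[OF m that, of c] by (simp add: k)
  define d where "d = (if even k then c else flip c)"
  have last: "alt_word d (flip d) m = alt_word d (flip d) k @ [c]"
    unfolding k alt_word_snoc by (auto simp: d_def)
  have right: "step m c (fold (step m) (alt_word d (flip d) k) (w, p)) = (w, p + 1)"
    if "(w, p) \<in> states m" for w p
    using fold_step_garside[OF m that, of d] unfolding last by simp
  show ?thesis
  proof (rule bij_betw_imageI)
    show "inj_on (step m c) (states m)"
    proof (rule inj_onI)
      fix n n' assume *: "n \<in> states m" "n' \<in> states m" "step m c n = step m c n'"
      then show "n = n'" using left[of "fst n" "snd n"] left[of "fst n'" "snd n'"]
        by (auto intro: prod_eqI)
    qed
    show "step m c ` states m = states m"
    proof
      show "states m \<subseteq> step m c ` states m"
      proof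
        fix n assume n: "n \<in> states m"
        then have s: "(fst n, snd n - 1) \<in> states m" by (simp add: states_def)
        have "n = step m c (fold (step m) (alt_word d (flip d) k) (fst n, snd n - 1))"
          using right[OF s] by simp
        then show "n \<in> step m c ` states m" using fold_step_in_states[OF m s] by blast
      qed
    qed (use step_in_states[OF m] in auto)
  qed
qed

fun act :: "nat \<Rightarrow> gen \<times> bool \<Rightarrow> state \<Rightarrow> state" where
  "act m (c, True) n = step m c n"
| "act m (c, False) n = inv_into (states m) (step m c) n"

lemma act_in_states: "m \<ge> 3 \<Longrightarrow> n \<in> states m \<Longrightarrow> act m s n \<in> states m"
  using bij_betw_step[of m] by (cases "(m, s, n)" rule: act.cases)
    (auto simp: step_in_states bij_betw_def inv_into_into)

lemma act_inverse: "m \<ge> 3 \<Longrightarrow> n \<in> states m \<Longrightarrow> act m (c, \<not> e) (act m (c, e) n) = n"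
  using bij_betw_step[of m c] by (cases e) (auto simp: bij_betw_inv_into_left bij_betw_inv_into_right)

lemma fold_act_in_states: "m \<ge> 3 \<Longrightarrow> n \<in> states m \<Longrightarrow> fold (act m) ws n \<in> states m"
  by (induction ws arbitrary: n) (auto simp: act_in_states)

lemma fold_act_pos_word: "fold (act m) (pos_word cs) n = fold (step m) cs n"
  by (induction cs arbitrary: n) (auto simp: pos_word_def)

lemma pos_word_simps [simp]: "pos_word [] = []" "pos_word (c # cs) = (c, True) # pos_word cs"
  "pos_word (cs @ ds) = pos_word cs @ pos_word ds"
  by (simp_all add: pos_word_def)

text \<open>By this invariance the state reached from a fixed state depends only on the group
  element, not on a word for it.\<close>

lemma fold_act_cong:
  assumes "pres_eq (dihedral_relations m) u v" "m \<ge> 3" "n \<in> states m"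
  shows "fold (act m) u n = fold (act m) v n"
  using assms
proof (induction arbitrary: n rule: pres_eq.induct)
  case (cancel u x e v)
  then show ?case by (simp add: act_inverse fold_act_in_states)
next
  case (relation r s u v)
  then have rs: "r = pos_word (alt_word GenA GenB m)" "s = pos_word (alt_word GenB GenA m)"
    by (auto simp: dihedral_relations_def)
  have "fold (act m) u n \<in> states m" using relation by (simp add: fold_act_in_states)
  then have "fold (act m) r (fold (act m) u n) = fold (act m) s (fold (act m) u n)"
    using fold_step_garside[of m _ _ GenA] fold_step_garside[of m _ _ GenB] relation.prems(1)
    by (cases "fold (act m) u n") (simp add: rs fold_act_pos_word)
  then show ?case by simp
qed auto


section \<open>Normal forms in the Artin group\<close>

text \<open>The exponent in \<open>new_gen\<close> is 0 because the power of \<Delta> stands to the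
  right of all factors.\<close>

fun nf_word :: "nat \<Rightarrow> nat list \<Rightarrow> gen list" where
  "nf_word m [] = []"
| "nf_word m (l # u) = nf_word m u @ alt_word (new_gen m (u, 0)) (flip (new_gen m (u, 0))) l"

locale dihedral_artin = group A for A (structure) +
  fixes m :: nat
  assumes m_ge_3: "m \<ge> 3" and A_eq: "A = artin m"

lemma dihedral_artin_artin: "m \<ge> 3 \<Longrightarrow> dihedral_artin (artin m) m"
  using group_presented_group by (auto simp: dihedral_artin_def dihedral_artin_axioms_def artin_def)

context dihedral_artin
begin

abbreviation cls :: "gen sword \<Rightarrow> gen sword set" where
  "cls \<equiv> pres_class (dihedral_relations m)"

abbreviation pos :: "gen list \<Rightarrow> gen sword set" where
  "pos cs \<equiv> cls (pos_word cs)"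

abbreviation garside_m :: "gen sword set" (\<open>\<Delta>\<close>) where
  "\<Delta> \<equiv> garside m"

lemma carrier_eq: "carrier A = range cls"
  by (simp add: A_eq artin_def carrier_presented_group)

lemma one_eq: "\<one> = cls []"
  by (simp add: A_eq artin_def one_presented_group)

lemma mult_cls: "cls u \<otimes> cls v = cls (u @ v)"
  by (simp add: A_eq artin_def mult_presented_group)

lemma cls_closed [simp]: "cls u \<in> carrier A"
  by (simp add: carrier_eq)

lemma artin_gen_eq: "artin_gen m c = pos [c]"
  by (simp add: artin_gen_def)

lemma garside_closed [simp]: "\<Delta> \<in> carrier A"
  by (simp add: garside_def)

lemma garside_eq: "\<Delta> = pos (alt_word c (flip c) m)"
proof (cases c)
  case GenB
  have "pres_eq (dihedral_relations m) (pos_word (alt_word GenA GenB m)) (pos_word (alt_word GenB GenA m))"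
    using pres_eq.relation[of _ _ "dihedral_relations m" "[]" "[]"] by (simp add: dihedral_relations_def)
  then show ?thesis using GenB by (simp add: garside_def pres_class_eq_iff)
qed (simp add: garside_def)

lemma mult_pos: "pos cs \<otimes> pos ds = pos (cs @ ds)"
  by (simp add: mult_cls)

text \<open>Conjugation by a power of \<Delta>: for odd \<open>m\<close>, \<Delta> exchanges the two
  generators, for even \<open>m\<close> it is central.\<close>

definition twist :: "int \<Rightarrow> gen \<Rightarrow> gen" where
  "twist p c = (if odd (int m * p) then flip c else c)"

text \<open>Both sides spell the same alternating word of length \<open>m + 1\<close>: its first
  \<open>m\<close> letters are a word for \<Delta>, and so are its last \<open>m\<close>.\<close>

lemma garside_mult_gen: "\<Delta> \<otimes> pos [c] = pos [twist 1 c] \<otimes> \<Delta>"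
proof -
  define x where "x = twist 1 c"
  have "alt_word x (flip x) (Suc m) = alt_word x (flip x) m @ [c]"
    unfolding alt_word_snoc by (auto simp: x_def twist_def)
  then have "pos (alt_word x (flip x) m) \<otimes> pos [c] = pos [x] \<otimes> pos (alt_word (flip x) (flip (flip x)) m)"
    unfolding mult_pos by simp
  then show ?thesis
    unfolding x_def[symmetric] garside_eq[symmetric] .
qed

lemma garside_pow_mult_gen: "\<Delta> [^] (p::int) \<otimes> pos [c] = pos [twist p c] \<otimes> \<Delta> [^] p"
proof (induction p arbitrary: c rule: int_induct[where k = 0])
  case base
  then show ?case by (simp add: twist_def)
next
  case (step1 p)
  have "\<Delta> [^] (p + 1) \<otimes> pos [c] = \<Delta> \<otimes> (\<Delta> [^] p \<otimes> pos [c])"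
    using int_pow_mult[of \<Delta> 1 p] by (simp add: add.commute m_assoc)
  also have "\<dots> = (\<Delta> \<otimes> pos [twist p c]) \<otimes> \<Delta> [^] p"
    using step1(2)[of c] by (simp add: m_assoc)
  also have "\<dots> = pos [twist 1 (twist p c)] \<otimes> (\<Delta> \<otimes> \<Delta> [^] p)"
    unfolding garside_mult_gen by (simp add: m_assoc)
  also have "\<dots> = pos [twist (p + 1) c] \<otimes> \<Delta> [^] (p + 1)"
    using int_pow_mult[of \<Delta> 1 p] by (simp add: add.commute twist_def)
  finally show ?case .
next
  case (step2 p)
  let ?c = "twist 1 (twist p c)"
  have p: "\<Delta> [^] p = \<Delta> \<otimes> \<Delta> [^] (p - 1)"
    using int_pow_mult[of \<Delta> 1 "p - 1"] by simp
  have "\<Delta> \<otimes> (\<Delta> [^] (p - 1) \<otimes> pos [c]) = \<Delta> [^] p \<otimes> pos [c]"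
    by (simp add: p m_assoc)
  also have "\<dots> = pos [twist 1 ?c] \<otimes> (\<Delta> \<otimes> \<Delta> [^] (p - 1))"
  proof -
    have "twist 1 ?c = twist p c" by (simp add: twist_def)
    then show ?thesis using step2(2)[of c] p by metis
  qed
  also have "\<dots> = \<Delta> \<otimes> (pos [?c] \<otimes> \<Delta> [^] (p - 1))"
    using garside_mult_gen[of ?c] by (simp add: m_assoc[symmetric])
  finally have "\<Delta> [^] (p - 1) \<otimes> pos [c] = pos [?c] \<otimes> \<Delta> [^] (p - 1)"
    by simp
  moreover have "?c = twist (p - 1) c" by (simp add: twist_def)
  ultimately show ?case by simp
qed

definition val :: "state \<Rightarrow> gen sword set" where
  "val n = pos (nf_word m (fst n)) \<otimes> \<Delta> [^] snd n"

lemma val_closed [simp]: "val n \<in> carrier A"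
  by (simp add: val_def)

lemma val_step:
  assumes "n \<in> states m"
  shows "val (step m c n) = val n \<otimes> pos [c]"
proof -
  from assms obtain l u p where n: "n = (l # u, p)" "l < m" "u \<noteq> [] \<Longrightarrow> 0 < l \<and> (u, p) \<in> states m"
    by (rule states_cases) blast
  \<comment> \<open>\<open>?c\<close> is the letter \<open>c\<close> after it has passed to the left
    of the power of \<Delta>. It meets the factors at exponent 0 just as \<open>c\<close> does at
    exponent \<open>p\<close>.\<close>
  let ?w = "l # u" and ?c = "twist p c"
  have top: "c = new_gen m (?w, p) \<longleftrightarrow> ?c = new_gen m (?w, 0)"
    using new_gen_shift[of m ?w 0 p] by (cases c; cases "new_gen m (?w, 0)") (auto simp: twist_def)
  have grow: "nf_word m (Suc l # u) = nf_word m ?w @ [?c]" if "?c \<noteq> new_gen m (?w, 0)"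
  proof -
    have "?c = flip (new_gen m (?w, 0))" using that by (simp add: neq_iff_eq_flip)
    then show ?thesis
      using new_gen_grow[of m 0 l u 0] unfolding nf_word.simps alt_word_snoc
      by (cases "even l") (auto simp: new_gen_def)
  qed
  have "val n \<otimes> pos [c] = pos (nf_word m ?w) \<otimes> (\<Delta> [^] p \<otimes> pos [c])"
    unfolding val_def n(1) by (simp add: m_assoc)
  also have "\<dots> = pos (nf_word m ?w) \<otimes> pos [?c] \<otimes> \<Delta> [^] p"
    unfolding garside_pow_mult_gen by (simp add: m_assoc)
  finally have rhs: "val n \<otimes> pos [c] = pos (nf_word m ?w @ [?c]) \<otimes> \<Delta> [^] p"
    unfolding mult_pos .
  show ?thesis
  proof (cases "?c = new_gen m (?w, 0)")
    case True
    then have "nf_word m (1 # ?w) = nf_word m ?w @ [?c]" by simp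
    moreover have "step m c n = (1 # ?w, p)" using True top n by simp
    ultimately show ?thesis unfolding rhs by (simp add: val_def)
  next
    case False
    show ?thesis
    proof (cases "Suc l < m")
      case True
      then have "step m c n = (Suc l # u, p)" using False top n by simp
      then show ?thesis unfolding rhs grow[OF False, symmetric] by (simp add: val_def)
    next
      case drop: False
      then have l: "Suc l = m" using n(2) by simp
      let ?d = "new_gen m (u, 0)"
      have "pos (nf_word m ?w @ [?c]) = pos (nf_word m u) \<otimes> pos (alt_word ?d (flip ?d) m)"
        unfolding grow[OF False, symmetric] mult_pos by (simp only: l nf_word.simps)
      then have "val n \<otimes> pos [c] = pos (nf_word m u) \<otimes> \<Delta> [^] (p + 1)"
        unfolding rhs garside_eq[symmetric] using int_pow_mult[of \<Delta> 1 p]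
        by (simp add: m_assoc add.commute)
      moreover have "step m c n = (if u = [] then [0] else u, p + 1)"
        using False drop top n by simp
      ultimately show ?thesis by (simp add: val_def)
    qed
  qed
qed

lemma cls_cancel: "cls [(c, e)] \<otimes> cls [(c, \<not> e)] = \<one>"
  using pres_eq.cancel[of "dihedral_relations m" "[]" c e "[]"]
  by (simp add: mult_cls one_eq pres_class_eq_iff)

lemma inv_cls_gen: "inv (cls [(c, e)]) = cls [(c, \<not> e)]"
  using cls_cancel[of c "\<not> e"] by (intro inv_equality) auto

lemma val_act:
  assumes "n \<in> states m"
  shows "val (act m s n) = val n \<otimes> cls [s]"
proof (cases s)
  case (Pair c e)
  show ?thesis
  proof (cases e)
    case True
    then show ?thesis using val_step[OF assms] Pair by simp
  next
    case False
    have "val (act m s n) \<otimes> pos [c] = val (step m c (act m s n))"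
      using val_step act_in_states[OF m_ge_3 assms] by simp
    also have "step m c (act m s n) = n"
      using act_inverse[OF m_ge_3 assms, of c False] False Pair by simp
    finally have "val n \<otimes> cls [s] = val (act m s n) \<otimes> (pos [c] \<otimes> cls [s])"
      by (simp add: m_assoc[symmetric])
    then show ?thesis using cls_cancel[of c True] False Pair by simp
  qed
qed

section \<open>The action of group elements on states\<close>

abbreviation base :: state where
  "base \<equiv> ([0], 0)"

lemma base_in_states [simp]: "base \<in> states m"
  using m_ge_3 by (simp add: states_def)

text \<open>A right action of the group. The choice of the word is harmless by
  \<open>fold_act_cong\<close>; outside the carrier the value is arbitrary, but it still maps states
  to states.\<close>

definition move :: "gen sword set \<Rightarrow> state \<Rightarrow> state" where
  "move g n = fold (act m) (SOME ws. g = cls ws) n"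

abbreviation st :: "gen sword set \<Rightarrow> state" where
  "st g \<equiv> move g base"

lemma move_cls: "n \<in> states m \<Longrightarrow> move (cls ws) n = fold (act m) ws n"
  unfolding move_def
  by (rule someI2[of _ ws]) (auto simp: pres_class_eq_iff intro: fold_act_cong[OF _ m_ge_3] pres_eq.sym)

lemma move_in_states [simp]: "n \<in> states m \<Longrightarrow> move g n \<in> states m"
  by (simp add: move_def fold_act_in_states m_ge_3)

lemma move_mult:
  assumes "g \<in> carrier A" "h \<in> carrier A" "n \<in> states m"
  shows "move (g \<otimes> h) n = move h (move g n)"
  using assms by (auto simp: carrier_eq mult_cls move_cls fold_act_in_states m_ge_3)

lemma move_one [simp]: "n \<in> states m \<Longrightarrow> move \<one> n = n"
  by (simp add: one_eq move_cls)

lemma move_pos: "n \<in> states m \<Longrightarrow> move (pos cs) n = fold (step m) cs n"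
  by (simp add: move_cls fold_act_pos_word)

lemma val_move: "g \<in> carrier A \<Longrightarrow> n \<in> states m \<Longrightarrow> val (move g n) = val n \<otimes> g"
proof -
  have "val (fold (act m) ws n) = val n \<otimes> cls ws" if "n \<in> states m" for ws
    using that
  proof (induction ws arbitrary: n)
    case Nil
    then show ?case by (simp add: one_eq[symmetric])
  next
    case (Cons s ws)
    then show ?case
      using mult_cls[of "[s]" ws] by (simp add: act_in_states m_ge_3 val_act m_assoc)
  qed
  then show "g \<in> carrier A \<Longrightarrow> n \<in> states m \<Longrightarrow> val (move g n) = val n \<otimes> g"
    by (auto simp: carrier_eq move_cls)
qed

lemma val_st: "g \<in> carrier A \<Longrightarrow> val (st g) = g"
  using val_move[of g base] by (simp add: val_def new_gen_def one_eq[symmetric])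

lemma st_inj: "g \<in> carrier A \<Longrightarrow> h \<in> carrier A \<Longrightarrow> st g = st h \<Longrightarrow> g = h"
  by (metis val_st)

lemma move_garside_pow: "(w, p) \<in> states m \<Longrightarrow> move (\<Delta> [^] (k::int)) (w, p) = (w, p + k)"
proof (induction k arbitrary: p rule: int_induct[where k = 0])
  case (step1 k)
  have in_states: "(w, p + k) \<in> states m" using step1.prems by (simp add: states_def)
  have "move (\<Delta> [^] k \<otimes> \<Delta>) (w, p) = move \<Delta> (w, p + k)"
    using step1 by (simp add: move_mult)
  also have "\<dots> = (w, p + (k + 1))"
    using fold_step_garside[OF m_ge_3 in_states, of GenA] garside_eq[of GenA] in_states
    by (simp add: move_pos)
  finally show ?case using int_pow_mult[of \<Delta> k 1] by simp
next
  case (step2 k)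
  have in_states: "(w, p - 1) \<in> states m" using step2.prems by (simp add: states_def)
  have "move \<Delta> (w, p - 1) = (w, p)"
    using fold_step_garside[OF m_ge_3 in_states, of GenA] garside_eq[of GenA] in_states
    by (simp add: move_pos)
  then have "move (\<Delta> [^] (k - 1)) (w, p) = move (\<Delta> \<otimes> \<Delta> [^] (k - 1)) (w, p - 1)"
    using in_states by (simp add: move_mult)
  also have "\<Delta> \<otimes> \<Delta> [^] (k - 1) = \<Delta> [^] k"
    using int_pow_mult[of \<Delta> 1 "k - 1"] by simp
  finally show ?case using step2.IH[OF in_states] by simp
qed simp

section \<open>Small steps in the tree of factor lists\<close>

lemma garside_sq_subgroup_eq: "garside_sq_subgroup m = {\<Delta> [^] (2 * k) | k :: int. True}"
proof -
  have "(\<Delta> [^] (2::nat)) [^] (k::int) = \<Delta> [^] (2 * k)" for k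
    using int_pow_pow[of \<Delta> 2 k] int_pow_int[of A \<Delta> 2] by simp
  then show ?thesis
    unfolding garside_sq_subgroup_def A_eq[symmetric] by (subst generate_pow) auto
qed

text \<open>Lists ordered by \<open>suffix\<close> form a tree. The two inclusions say that a letter
  pushes an entry, pops one or changes the head, so that it never moves further than to a parent, a
  child or a sibling.\<close>

lemma step_suffix:
  assumes "n \<in> states m"
  shows "suffix (tl (fst (step m c n))) (fst n)" "suffix (tl (fst n)) (fst (step m c n))"
proof -
  from assms obtain l u p where "n = (l # u, p)" by (rule states_cases) blast
  then show "suffix (tl (fst (step m c n))) (fst n)" "suffix (tl (fst n)) (fst (step m c n))"
    by (cases u; simp add: suffix_Cons)+
qed

lemma act_suffix:
  assumes "n \<in> states m"
  shows "suffix (tl (fst (act m s n))) (fst n)" "suffix (tl (fst n)) (fst (act m s n))"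
proof -
  obtain c e where s: "s = (c, e)" by fastforce
  have "act m s n \<in> states m" using act_in_states[OF m_ge_3 assms] .
  moreover have "step m c (act m (c, False) n) = n" using act_inverse[OF m_ge_3 assms, of c False] by simp
  ultimately show "suffix (tl (fst (act m s n))) (fst n)" "suffix (tl (fst n)) (fst (act m s n))"
    using step_suffix[OF assms] step_suffix[of "act m s n" c] s by (cases e; simp)+
qed

text \<open>Any power of \<open>\<Delta>\<^sup>2\<close> counts as a single step: it leaves the list
  of factors unchanged and is a generator in each of the four sets.\<close>

definition small_steps :: "gen sword set set" where
  "small_steps = range (\<lambda>s. cls [s]) \<union> garside_sq_subgroup m"

lemma small_steps_closed: "small_steps \<subseteq> carrier A"
  by (auto simp: small_steps_def garside_sq_subgroup_eq)

lemma small_step_suffix: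
  assumes "y \<in> small_steps" "n \<in> states m"
  shows "suffix (tl (fst (move y n))) (fst n)" "suffix (tl (fst n)) (fst (move y n))"
  using assms act_suffix[OF assms(2)] move_garside_pow[of "fst n" "snd n"]
  by (auto simp: small_steps_def garside_sq_subgroup_eq move_cls suffix_tl)

lemma states_fst_nonempty: "n \<in> states m \<Longrightarrow> fst n \<noteq> []"
  by (auto simp: states_def)

text \<open>Followed backwards, a proper suffix of the current list remains a suffix of the previous
  one. The path begins at \<open>[0]\<close>, whose only nonempty suffix is the whole list, so at
  some vertex \<open>u\<close> has to be the whole list.\<close>

lemma passes_suffix:
  assumes "set ws \<subseteq> small_steps" "suffix u (fst (st (foldr (\<otimes>) ws \<one>)))" "u \<noteq> []"
  shows "\<exists>i\<le>length ws. fst (st (foldr (\<otimes>) (take i ws) \<one>)) = u"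
  using assms
proof (induction ws rule: rev_induct)
  case Nil
  then show ?case by (auto simp: suffix_Cons)
next
  case (snoc y ws)
  have c: "set ws \<subseteq> carrier A" "y \<in> carrier A" using snoc.prems(1) small_steps_closed by auto
  let ?g = "foldr (\<otimes>) ws \<one>"
  have g: "?g \<in> carrier A" using c by (auto intro: foldr_mult_closed)
  have prod: "foldr (\<otimes>) (ws @ [y]) \<one> = ?g \<otimes> y"
    using foldr_mult_append[of ws "[y]"] c by simp
  let ?w = "fst (st (?g \<otimes> y))"
  show ?case
  proof (cases "u = ?w")
    case True
    then show ?thesis using prod by (intro exI[of _ "Suc (length ws)"]) simp
  next
    case False
    have "st (?g \<otimes> y) = move y (st ?g)" using g c by (simp add: move_mult)
    then have "suffix (tl ?w) (fst (st ?g))"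
      using small_step_suffix(1)[of y "st ?g"] snoc.prems(1) by simp
    moreover have "suffix u (tl ?w)"
      using False snoc.prems(2) unfolding prod by (cases ?w) (auto simp: suffix_Cons)
    ultimately have "suffix u (fst (st ?g))" using suffix_order.trans by blast
    then obtain i where "i \<le> length ws" "fst (st (foldr (\<otimes>) (take i ws) \<one>)) = u"
      using snoc by auto
    then show ?thesis by (intro exI[of _ i]) simp
  qed
qed

lemma pos_eq_foldr: "pos cs = foldr (\<otimes>) (map (\<lambda>c. pos [c]) cs) \<one>"
proof (induction cs)
  case Nil
  then show ?case by (simp add: one_eq)
next
  case (Cons c cs)
  then show ?case using mult_cls[of "pos_word [c]" "pos_word cs"] by simp
qed

lemma word_norm_pos_le:
  assumes X: "generating_set A X" and C: "\<And>y. y \<in> small_steps \<Longrightarrow> word_norm A X y \<le> C"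
  shows "word_norm A X (pos cs) \<le> C * length cs"
proof -
  have "word_norm A X (foldr (\<otimes>) (map (\<lambda>c. pos [c]) cs) \<one>) \<le> C * length (map (\<lambda>c. pos [c]) cs)"
    using C by (intro word_norm_foldr_le[OF X]) (auto simp: small_steps_def)
  then show ?thesis by (simp only: pos_eq_foldr[of cs] length_map)
qed

text \<open>An even power of \<Delta> is one small step, and a possible remaining \<Delta> has
  \<open>m\<close> letters.\<close>

lemma word_norm_garside_pow_le:
  assumes X: "generating_set A X" and C: "\<And>y. y \<in> small_steps \<Longrightarrow> word_norm A X y \<le> C"
  shows "word_norm A X (\<Delta> [^] (k::int)) \<le> C * (m + 1)"
proof -
  have "\<Delta> [^] (2 * (k div 2)) \<in> garside_sq_subgroup m" by (auto simp: garside_sq_subgroup_eq)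
  then have 1: "word_norm A X (\<Delta> [^] (2 * (k div 2))) \<le> C" using C by (simp add: small_steps_def)
  have "k mod 2 = 0 \<or> k mod 2 = 1" by auto
  then have 2: "word_norm A X (\<Delta> [^] (k mod 2)) \<le> C * m"
    using word_norm_pos_le[OF assms, of "alt_word GenA GenB m"] garside_eq[of GenA] by auto
  have "\<Delta> [^] k = \<Delta> [^] (2 * (k div 2)) \<otimes> \<Delta> [^] (k mod 2)"
    using int_pow_mult[of \<Delta> "2 * (k div 2)" "k mod 2"] by simp
  then show ?thesis
    using word_norm_mult_le[OF X, of "\<Delta> [^] (2 * (k div 2))" "\<Delta> [^] (k mod 2)"] 1 2 by simp
qed

lemma valid_lengths_suffix: "valid_lengths m w \<Longrightarrow> suffix u w \<Longrightarrow> u \<noteq> [] \<Longrightarrow> valid_lengths m u"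
  by (induction w) (auto simp: suffix_Cons)

text \<open>The bottlenecks of \<open>g\<close> are the products of the first factors of its normal form.\<close>

lemma hyperbolic_structure_if_refinable:
  assumes X: "generating_set A X"
    and small: "\<And>y. y \<in> small_steps \<Longrightarrow> word_norm A X y \<le> C"
    and refine: "\<And>s. s \<in> X \<union> set_inv X \<Longrightarrow> \<exists>ws. set ws \<subseteq> small_steps \<and> foldr (\<otimes>) ws \<one> = s \<and>
        (\<forall>i. word_norm A X (foldr (\<otimes>) (take i ws) \<one>) \<le> C)"
  shows "hyperbolic_structure A X"
proof (rule hyperbolic_structure_if_bottleneck[OF X small_steps_closed, where C = "C * (m + 1)"])
  fix s assume "s \<in> X \<union> set_inv X"
  then show "\<exists>ws. set ws \<subseteq> small_steps \<and> foldr (\<otimes>) ws \<one> = s \<and>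
        (\<forall>i. word_norm A X (foldr (\<otimes>) (take i ws) \<one>) \<le> C * (m + 1))"
    using refine[of s] by (fastforce intro: trans_le_add1)
next
  fix g assume g: "g \<in> carrier A"
  define near where "near p \<longleftrightarrow> p \<in> carrier A \<and> (\<forall>ws. set ws \<subseteq> small_steps \<longrightarrow> foldr (\<otimes>) ws \<one> = g \<longrightarrow>
      (\<exists>i. word_norm A X (inv (foldr (\<otimes>) (take i ws) \<one>) \<otimes> p) \<le> C * (m + 1)))" for p
  let ?R = "\<lambda>p q. near p \<and> near q \<and> word_norm A X (inv p \<otimes> q) \<le> C * (m + 1)"
  obtain w p where st_g: "st g = (w, p)" by fastforce
  have w: "valid_lengths m w" using move_in_states[OF base_in_states, of g] st_g by (simp add: states_def)
  have near_one: "near \<one>" by (auto simp: near_def intro: exI[of _ 0])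
  have near_g: "near g"
    unfolding near_def
  proof (intro conjI g allI impI)
    fix ws assume "foldr (\<otimes>) ws \<one> = g"
    then show "\<exists>i. word_norm A X (inv (foldr (\<otimes>) (take i ws) \<one>) \<otimes> g) \<le> C * (m + 1)"
      using g by (intro exI[of _ "length ws"]) simp
  qed
  have near: "near (pos (nf_word m u))" if u: "suffix u w" "u \<noteq> []" for u
    unfolding near_def
  proof (intro conjI allI impI)
    fix ws assume ws: "set ws \<subseteq> small_steps" "foldr (\<otimes>) ws \<one> = g"
    obtain i where i: "fst (st (foldr (\<otimes>) (take i ws) \<one>)) = u"
      using passes_suffix[OF ws(1) _ u(2)] u(1) ws(2) st_g by auto
    let ?q = "foldr (\<otimes>) (take i ws) \<one>" let ?k = "snd (st ?q)"
    have "set (take i ws) \<subseteq> carrier A"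
      using ws(1) small_steps_closed set_take_subset[of i ws] by blast
    then have q: "?q \<in> carrier A" by (rule foldr_mult_closed)
    \<comment> \<open>A vertex with list \<open>u\<close> differs from the bottleneck only by a
      power of \<Delta>, which is bounded whatever its exponent.\<close>
    have "?q = pos (nf_word m u) \<otimes> \<Delta> [^] ?k" using val_st[OF q] i by (simp add: val_def)
    moreover have "inv (pos (nf_word m u) \<otimes> \<Delta> [^] k) \<otimes> pos (nf_word m u) = \<Delta> [^] (- k)" for k :: int
      by (simp add: inv_mult_group m_assoc int_pow_neg)
    ultimately have "inv ?q \<otimes> pos (nf_word m u) = \<Delta> [^] (- ?k)" by metis
    then show "\<exists>i. word_norm A X (inv (foldr (\<otimes>) (take i ws) \<one>) \<otimes> pos (nf_word m u)) \<le> C * (m + 1)"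
      using word_norm_garside_pow_le[OF X small] by metis
  qed simp
  \<comment> \<open>Consecutive bottlenecks differ by one factor, an alternating word shorter than
    \<open>m\<close>. The empty list contributes the identity as the start of the chain.\<close>
  have chain: "suffix u w \<Longrightarrow> u \<noteq> [] \<Longrightarrow> ?R\<^sup>*\<^sup>* \<one> (pos (nf_word m u))" for u
  proof (induction u)
    case (Cons l u)
    let ?c = "new_gen m (u, 0)"
    have l: "l < m" using valid_lengths_suffix[OF w Cons.prems] by simp
    have "inv (pos (nf_word m u)) \<otimes> pos (nf_word m (l # u)) = pos (alt_word ?c (flip ?c) l)"
      using mult_pos[of "nf_word m u" "alt_word ?c (flip ?c) l"]
      by (simp add: inv_solve_left' flip: pos_word_simps(3))
    then have short: "word_norm A X (inv (pos (nf_word m u)) \<otimes> pos (nf_word m (l # u))) \<le> C * (m + 1)"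
      using word_norm_pos_le[OF X small, of "alt_word ?c (flip ?c) l"] l
        mult_le_mono2[of l "m + 1" C] by simp
    have "near (pos (nf_word m u)) \<and> ?R\<^sup>*\<^sup>* \<one> (pos (nf_word m u))"
    proof (cases "u = []")
      case True
      then show ?thesis using near_one by (simp add: one_eq)
    next
      case False
      have "suffix u w" using Cons.prems(1) by (rule suffix_ConsD)
      then show ?thesis using near[of u] Cons.IH False by blast
    qed
    moreover from this have "?R (pos (nf_word m u)) (pos (nf_word m (l # u)))"
      using short near[OF Cons.prems] by blast
    ultimately show ?case by (blast intro: rtranclp.rtrancl_into_rtrancl[of ?R])
  qed simp
  have w_ne: "w \<noteq> []" using w by auto
  have "?R\<^sup>*\<^sup>* \<one> (pos (nf_word m w))" using chain[OF suffix_order.refl w_ne] .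
  moreover have "?R (pos (nf_word m w)) g"
  proof -
    have "g = pos (nf_word m w) \<otimes> \<Delta> [^] p" using val_st[OF g] st_g by (simp add: val_def)
    then have "inv (pos (nf_word m w)) \<otimes> g = \<Delta> [^] p" by (simp flip: m_assoc)
    then show ?thesis using near[OF suffix_order.refl w_ne] near_g word_norm_garside_pow_le[OF X small] by auto
  qed
  ultimately have "?R\<^sup>*\<^sup>* \<one> g" by (rule rtranclp.rtrancl_into_rtrancl)
  then show "(\<lambda>p q. (p \<in> carrier A \<and> (\<forall>ws. set ws \<subseteq> small_steps \<longrightarrow> foldr (\<otimes>) ws \<one> = g \<longrightarrow>
      (\<exists>i. word_norm A X (inv (foldr (\<otimes>) (take i ws) \<one>) \<otimes> p) \<le> C * (m + 1)))) \<and>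
      (q \<in> carrier A \<and> (\<forall>ws. set ws \<subseteq> small_steps \<longrightarrow> foldr (\<otimes>) ws \<one> = g \<longrightarrow>
      (\<exists>i. word_norm A X (inv (foldr (\<otimes>) (take i ws) \<one>) \<otimes> q) \<le> C * (m + 1))))
      \<and> word_norm A X (inv p \<otimes> q) \<le> C * (m + 1))\<^sup>*\<^sup>* \<one> g"
    unfolding near_def .
qed


section \<open>Refining words into small steps\<close>

abbreviation sigma :: "gen \<Rightarrow> gen sword set" where
  "sigma c \<equiv> cls [(c, True)]"

abbreviation std_and_center :: "gen sword set set" where
  "std_and_center \<equiv> std_gens m \<union> garside_sq_subgroup m"

lemma std_gens_eq: "std_gens m = range (\<lambda>c. sigma c)"
proof -
  have gens: "(UNIV :: gen set) = {GenA, GenB}" using gen.exhaust by blast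
  show ?thesis unfolding std_gens_def artin_gen_eq gens by simp
qed

lemma cls_in_generate:
  assumes "std_gens m \<subseteq> generate A X" "X \<subseteq> carrier A"
  shows "cls ws \<in> generate A X"
proof (induction ws)
  case Nil
  then show ?case using generate.one[of A X] by (simp add: one_eq)
next
  case (Cons s ws)
  obtain c e where s: "s = (c, e)" by fastforce
  have c: "sigma c \<in> generate A X" using assms(1) by (auto simp: std_gens_eq)
  then have "cls [s] \<in> generate A X"
    using generate_m_inv_closed[OF assms(2) c] inv_cls_gen[of c True] s by (cases e) auto
  then have "cls [s] \<otimes> cls ws \<in> generate A X" using Cons.IH by (rule generate.eng)
  then show ?case by (simp add: mult_cls)
qed

lemma generating_setI:
  assumes "std_gens m \<subseteq> X" "X \<subseteq> carrier A"
  shows "generating_set A X"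
proof -
  have "std_gens m \<subseteq> generate A X" using assms(1) by (auto intro: generate.incl)
  then have "carrier A \<subseteq> generate A X" using cls_in_generate[OF _ assms(2)] by (auto simp: carrier_eq)
  then show ?thesis
    using assms(2) generate_in_carrier[OF assms(2)] by (auto simp: generating_set_def)
qed

lemma small_step_norm_le_1:
  assumes "std_and_center \<subseteq> X" "X \<subseteq> carrier A" "y \<in> small_steps"
  shows "word_norm A X y \<le> 1"
proof (cases "y \<in> garside_sq_subgroup m")
  case True
  then show ?thesis using assms by (intro word_norm_gen_le_1) auto
next
  case False
  then obtain c e where "y = cls [(c, e)]" using assms(3) by (auto simp: small_steps_def)
  moreover have "word_norm A X (sigma c) \<le> 1"
    using assms by (intro word_norm_gen_le_1) (auto simp: std_gens_eq)
  moreover have "generating_set A X" using assms by (intro generating_setI) auto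
  ultimately show ?thesis using word_norm_inv[of X "sigma c"] inv_cls_gen[of c True] by (cases e) auto
qed

text \<open>The condition that \<open>hyperbolic_structure_if_refinable\<close> asks of each
  generator, in a form that can be combined along products.\<close>

definition refinable :: "gen sword set set \<Rightarrow> nat \<Rightarrow> gen sword set \<Rightarrow> bool" where
  "refinable X C s \<longleftrightarrow> (\<exists>ws. set ws \<subseteq> small_steps \<and> foldr (\<otimes>) ws \<one> = s \<and>
     (\<forall>i. word_norm A X (foldr (\<otimes>) (take i ws) \<one>) \<le> C))"

lemma refinable_mono: "refinable X C s \<Longrightarrow> C \<le> D \<Longrightarrow> refinable X D s"
  unfolding refinable_def by (elim exE conjE, rule exI, intro conjI) (auto intro: order_trans)

lemma small_steps_word_closed:
  assumes "set ws \<subseteq> small_steps"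
  shows "set ws \<subseteq> carrier A" "foldr (\<otimes>) ws \<one> \<in> carrier A" "set (take i ws) \<subseteq> carrier A"
    "foldr (\<otimes>) (take i ws) \<one> \<in> carrier A"
  using assms small_steps_closed set_take_subset[of i ws] by (auto intro!: foldr_mult_closed)

lemma refinable_small:
  assumes "y \<in> small_steps" "word_norm A X y \<le> C"
  shows "refinable X C y"
  unfolding refinable_def
proof (intro exI[of _ "[y]"] conjI allI)
  fix i show "word_norm A X (foldr (\<otimes>) (take i [y]) \<one>) \<le> C"
    using assms small_steps_closed by (cases i) auto
qed (use assms small_steps_closed in auto)

lemma refinable_mult:
  assumes X: "generating_set A X" and s: "refinable X C s" and t: "refinable X D t"
  shows "refinable X (C + D) (s \<otimes> t)"
proof -
  obtain us where us: "set us \<subseteq> small_steps" "foldr (\<otimes>) us \<one> = s"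
    "\<And>i. word_norm A X (foldr (\<otimes>) (take i us) \<one>) \<le> C" using s by (auto simp: refinable_def)
  obtain vs where vs: "set vs \<subseteq> small_steps" "foldr (\<otimes>) vs \<one> = t"
    "\<And>i. word_norm A X (foldr (\<otimes>) (take i vs) \<one>) \<le> D" using t by (auto simp: refinable_def)
  note closed = small_steps_word_closed[OF us(1)] small_steps_word_closed[OF vs(1)]
  have s_norm: "word_norm A X s \<le> C" using us(3)[of "length us"] us(2) by simp
  have "word_norm A X (foldr (\<otimes>) (take i (us @ vs)) \<one>) \<le> C + D" for i
  proof (cases "i \<le> length us")
    case True
    then show ?thesis using us(3)[of i] by simp
  next
    case False
    have "foldr (\<otimes>) (take i (us @ vs)) \<one> = s \<otimes> foldr (\<otimes>) (take (i - length us) vs) \<one>"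
      using False closed us(2) foldr_mult_append[of us "take (i - length us) vs"] by simp
    moreover have "word_norm A X (s \<otimes> foldr (\<otimes>) (take (i - length us) vs) \<one>)
        \<le> word_norm A X s + word_norm A X (foldr (\<otimes>) (take (i - length us) vs) \<one>)"
      using closed us(2) by (intro word_norm_mult_le[OF X]) auto
    ultimately show ?thesis using s_norm vs(3)[of "i - length us"] by simp
  qed
  then show ?thesis unfolding refinable_def using us vs closed
    by (intro exI[of _ "us @ vs"]) (simp add: foldr_mult_append del: foldr_append)
qed

lemma refinable_cls:
  assumes X: "generating_set A X" and C: "\<And>y. y \<in> small_steps \<Longrightarrow> word_norm A X y \<le> C"
  shows "refinable X (C * length ws) (cls ws)"
proof (induction ws)
  case Nil
  then show ?case by (auto simp: refinable_def one_eq[symmetric] intro!: exI[of _ "[]"])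
next
  case (Cons s ws)
  have "cls [s] \<in> small_steps" by (simp add: small_steps_def)
  then have "refinable X (C + C * length ws) (cls [s] \<otimes> cls ws)"
    using C by (intro refinable_mult[OF X refinable_small Cons.IH])
  then show ?case by (simp add: mult_cls)
qed

lemma refinable_garside_pow:
  assumes X: "generating_set A X" and C: "\<And>y. y \<in> small_steps \<Longrightarrow> word_norm A X y \<le> C"
  shows "refinable X (C * (m + 1)) (\<Delta> [^] (k::int))"
proof -
  have "\<Delta> [^] (2 * (k div 2)) \<in> small_steps" by (auto simp: garside_sq_subgroup_eq small_steps_def)
  then have 1: "refinable X C (\<Delta> [^] (2 * (k div 2)))" using C by (intro refinable_small) auto
  have "k mod 2 = 0 \<or> k mod 2 = 1" by auto
  moreover have "refinable X (C * m) \<Delta>"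
    using refinable_cls[OF assms, of "pos_word (alt_word GenA GenB m)"]
    by (simp add: garside_eq[of GenA] pos_word_def)
  moreover have "refinable X (C * m) \<one>"
    using refinable_mono[OF refinable_cls[OF assms, of "[]"]] by (simp add: one_eq)
  ultimately have 2: "refinable X (C * m) (\<Delta> [^] (k mod 2))" by auto
  have "\<Delta> [^] k = \<Delta> [^] (2 * (k div 2)) \<otimes> \<Delta> [^] (k mod 2)"
    using int_pow_mult[of \<Delta> "2 * (k div 2)" "k mod 2"] by simp
  then show ?thesis using refinable_mult[OF X 1 2] by simp
qed

lemma int_pow_eq_nat_pow:
  assumes "g \<in> carrier A"
  shows "g [^] (k::int) = (if k \<ge> 0 then g else inv g) [^] nat \<bar>k\<bar>"
proof (cases "k \<ge> 0")
  case True
  then show ?thesis using int_pow_int[of A g "nat k"] by simp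
next
  case False
  then show ?thesis using int_pow_neg_int[of g "nat (- k)"] nat_pow_inv[of g "nat (- k)"] assms by simp
qed

lemma funpow_mult_one: "g \<in> carrier A \<Longrightarrow> ((\<otimes>) g ^^ k) \<one> = g [^] (k::nat)"
proof (induction k)
  case (Suc k)
  then show ?case using nat_pow_Suc2[of g k] by simp
qed simp

lemma generate_gen_eq: "generate A {sigma c} = {sigma c [^] k | k :: int. True}"
  using generate_pow[OF cls_closed] by simp

text \<open>Every prefix of a power of \<open>sigma c\<close> is itself a generator in
  \<open>X\<close>, so the bound is independent of \<open>k\<close>.\<close>

lemma refinable_gen_pow:
  assumes X: "generating_set A X" and sub: "generate A {sigma c} \<subseteq> X"
  shows "refinable X 1 (sigma c [^] (k::int))"
proof -
  define e where "e \<longleftrightarrow> k \<ge> 0"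
  define y where "y = cls [(c, e)]"
  have inv_y: "y = (if k \<ge> 0 then sigma c else inv (sigma c))"
    using inv_cls_gen[of c True] by (auto simp: y_def e_def)
  have y: "y \<in> small_steps" "y \<in> carrier A" by (auto simp: y_def small_steps_def)
  have pow: "y [^] (i::nat) \<in> generate A {sigma c}" for i
  proof -
    have "y [^] i = sigma c [^] (if k \<ge> 0 then int i else - int i)"
      unfolding inv_y by (cases "k \<ge> 0") (simp_all only: if_True if_False int_pow_int int_pow_neg_int nat_pow_inv cls_closed)
    then show ?thesis unfolding generate_gen_eq by blast
  qed
  have "X \<subseteq> carrier A" using X by (simp add: generating_set_def)
  then have "word_norm A X (y [^] i) \<le> 1" for i :: nat
    using pow[of i] sub by (intro word_norm_gen_le_1) auto
  moreover have "sigma c [^] k = y [^] nat \<bar>k\<bar>"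
    unfolding inv_y by (rule int_pow_eq_nat_pow) simp
  ultimately show ?thesis
    unfolding refinable_def using y(1) funpow_mult_one[OF y(2)]
    by (intro exI[of _ "replicate (nat \<bar>k\<bar>) y"] conjI allI) (auto simp: take_replicate)
qed

section \<open>Normalizers of the standard parabolic subgroups\<close>

lemma move_gen_pow: "n \<in> states m \<Longrightarrow> move (sigma c [^] (k::nat)) n = (step m c ^^ k) n"
proof (induction k)
  case (Suc k)
  then have "move (sigma c [^] k \<otimes> sigma c) n = step m c ((step m c ^^ k) n)"
    using move_in_states[of n "sigma c [^] k"] by (simp add: move_mult move_cls del: move_in_states)
  then show ?case by simp
qed simp

lemma new_gen_replicate [simp]: "new_gen m (replicate k (Suc 0) @ w, p) = new_gen m (w, p)"
  by (induction k) auto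

text \<open>An entry 1 adds 1 to the sum and 1 to the length, so the parity in
  \<open>new_gen\<close> is preserved. Once \<open>c\<close> opens a factor, each further
  \<open>c\<close> does so too, and powers of \<open>c\<close> become runs of ones.\<close>

lemma funpow_step_push:
  "w \<noteq> [] \<Longrightarrow> new_gen m (w, p) = c \<Longrightarrow> (step m c ^^ k) (w, p) = (replicate k (Suc 0) @ w, p)"
proof (induction k)
  case (Suc k)
  obtain l u where lu: "replicate k (Suc 0) @ w = l # u" using Suc.prems by (cases "replicate k (Suc 0) @ w") auto
  have "new_gen m (l # u, p) = c" using Suc.prems by (simp flip: lu)
  then show ?case using Suc by (simp add: lu)
qed simp

text \<open>As long as \<open>c\<close> does not open a factor, it lengthens or wraps the head,
  which switches \<open>new_gen\<close> to \<open>c\<close>, or it pops the head; pops are limited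
  by the length of the list.\<close>

lemma exists_push_mode:
  "n \<in> states m \<Longrightarrow> \<exists>k. new_gen m ((step m c ^^ k) n) = c"
proof (induction "length (fst n)" arbitrary: n rule: less_induct)
  case less
  obtain l u p where n: "n = (l # u, p)" "l < m" "u \<noteq> [] \<Longrightarrow> 0 < l \<and> (u, p) \<in> states m"
    using less.prems by (rule states_cases) blast
  show ?case
  proof (cases "new_gen m n = c")
    case True
    then show ?thesis by (intro exI[of _ 0]) simp
  next
    case False
    then have c: "c = flip (new_gen m n)" by (metis neq_iff_eq_flip)
    show ?thesis
    proof (cases "Suc l < m \<or> u = []")
      case True
      then have "new_gen m (step m c n) = c"
        using c n new_gen_Suc[of m l u p] new_gen_wrap[of l m p] by auto
      then show ?thesis by (intro exI[of _ 1]) simp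
    next
      case False
      then have "step m c n = (u, p + 1)" "(u, p + 1) \<in> states m" using c n by (auto simp: states_def)
      moreover obtain k where "new_gen m ((step m c ^^ k) (u, p + 1)) = c"
        using less.hyps[of "(u, p + 1)"] n(1) calculation(2) by auto
      ultimately show ?thesis by (intro exI[of _ "Suc k"]) (simp add: funpow_swap1)
    qed
  qed
qed

text \<open>Each letter, positive or negative, disturbs at most the current head, so
  \<open>v\<close> cannot reach entries deeper than its length.\<close>

lemma fold_act_suffix:
  "n \<in> states m \<Longrightarrow> suffix r (fst n) \<Longrightarrow> length r + length v \<le> length (fst n) \<Longrightarrow>
   suffix r (fst (fold (act m) v n))"
proof (induction v arbitrary: n)
  case (Cons s v)
  have "fst n \<noteq> []" using Cons.prems(3) by auto
  then have "suffix r (tl (fst n))" using Cons.prems(2,3) by (cases "fst n") (auto simp: suffix_Cons)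
  moreover have "suffix (tl (fst n)) (fst (act m s n))" by (rule act_suffix(2)[OF Cons.prems(1)])
  moreover have "length (fst (act m s n)) \<ge> length (tl (fst n))"
    using act_suffix(2)[OF Cons.prems(1)] by (rule suffix_length_le)
  ultimately show ?case
    using Cons.prems by (auto intro!: Cons.IH simp: act_in_states m_ge_3 intro: suffix_order.trans)
qed simp

text \<open>The first factor starts with \<open>GenB\<close> by convention. Hence
  \<open>GenA\<close> opens a factor already at \<open>base\<close>, but \<open>GenB\<close> only
  after one letter has entered the first factor.\<close>

lemma exists_pow_single: "\<exists>j x. st (sigma c [^] (j::nat)) = ([x], 0) \<and> new_gen m ([x], 0) = c"
proof (cases c)
  case GenA
  then show ?thesis by (intro exI[of _ 0] exI[of _ 0]) (simp add: new_gen_def)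
next
  case GenB
  then show ?thesis using m_ge_3 move_pos[of base "[c]"]
    by (intro exI[of _ "1::nat"] exI[of _ 1]) (simp add: new_gen_def)
qed

text \<open>If \<open>g\<close> commutes with \<open>c\<close>, then the normal forms of \<open>g c\<^sup>k = c\<^sup>k g\<close> for large \<open>k\<close> extend that of \<open>g\<close>
  (once \<open>g\<close> is multiplied by a power of \<open>c\<close>) and also start with a long power of \<open>c\<close>.\<close>

lemma commutes_with_gen:
  assumes g: "g \<in> carrier A" and comm: "g \<otimes> sigma c = sigma c \<otimes> g"
  shows "\<exists>(i::int) (p::int). g = sigma c [^] i \<otimes> \<Delta> [^] p"
proof -
  let ?c = "sigma c"
  have comm_pow: "g \<otimes> ?c [^] k = ?c [^] k \<otimes> g" for k :: nat
    using g comm by (induction k) (simp_all, simp add: m_assoc[symmetric], simp add: m_assoc)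
  \<comment> \<open>Beyond the power \<open>j0\<close>, multiplication by \<open>c\<close> only
    pushes ones.\<close>
  obtain j0 where j0: "new_gen m ((step m c ^^ j0) (st g)) = c"
    using exists_push_mode by (metis base_in_states move_in_states)
  define h where "h = g \<otimes> ?c [^] j0"
  have h: "h \<in> carrier A" using g by (simp add: h_def)
  obtain w p where st_h: "st h = (w, p)" by fastforce
  have w: "(w, p) \<in> states m" using move_in_states[OF base_in_states, of h] st_h by simp
  have push: "new_gen m (w, p) = c"
    using j0 st_h g by (simp add: h_def move_mult move_gen_pow)
  have w_ne: "w \<noteq> []" using states_fst_nonempty[OF w] by simp
  obtain j :: nat and x where jx: "st (?c [^] j) = ([x], 0)" "new_gen m ([x], 0) = c"
    using exists_pow_single by blast
  have x: "([x], 0) \<in> states m" using move_in_states[OF base_in_states, of "?c [^] j"] jx by simp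
  obtain v where v: "h = cls v" using h by (auto simp: carrier_eq)
  \<comment> \<open>Long enough that a word \<open>v\<close> for \<open>h\<close>, applied after
    this run of ones, leaves at least \<open>length w\<close> of them intact.\<close>
  define k where "k = length v + length w"
  have pow_k: "st (?c [^] (j + i)) = (replicate i (Suc 0) @ [x], 0)" for i
    using jx x funpow_step_push[of "[x]" 0 c i]
    by (simp add: nat_pow_mult[symmetric] move_mult move_gen_pow)
  have "h \<otimes> ?c [^] (j + k) = ?c [^] (j + k) \<otimes> h"
    using g comm_pow[of "j + k"] nat_pow_comm[of ?c j0 "j + k"]
    by (simp add: h_def m_assoc) (simp add: m_assoc[symmetric])
  moreover have "st (h \<otimes> ?c [^] (j + k)) = (replicate (j + k) (Suc 0) @ w, p)"
    using h st_h w funpow_step_push[OF w_ne push] by (simp add: move_mult move_gen_pow)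
  moreover have "st (?c [^] (j + k) \<otimes> h) = fold (act m) v (replicate k (Suc 0) @ [x], 0)"
    using pow_k[of k] move_in_states[OF base_in_states, of "?c [^] (j + k)"] by (simp add: move_mult h v move_cls)
  ultimately have eq: "fst (fold (act m) v (replicate k (Suc 0) @ [x], 0)) = replicate (j + k) (Suc 0) @ w" by simp
  have "suffix (replicate (length w) (Suc 0) @ [x]) (fst (fold (act m) v (replicate k (Suc 0) @ [x], 0)))"
  proof (rule fold_act_suffix)
    show "(replicate k (Suc 0) @ [x], 0) \<in> states m"
      using pow_k[of k] move_in_states[OF base_in_states, of "?c [^] (j + k)"] by simp
    show "suffix (replicate (length w) (Suc 0) @ [x]) (fst (replicate k (Suc 0) @ [x], 0))"
      unfolding k_def by (simp add: replicate_add suffix_def)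
  qed (simp add: k_def)
  then have "suffix (replicate (length w) (Suc 0) @ [x]) (replicate (j + k) (Suc 0) @ w)" unfolding eq .
  \<comment> \<open>Both lists are suffixes of one list, and \<open>w\<close> is the shorter one. So
    \<open>w\<close> is itself a run of ones followed by \<open>x\<close>.\<close>
  then have "suffix w (replicate (length w) (Suc 0) @ [x])"
    by (rule suffix_length_suffix[rotated]) (auto simp: suffix_def)
  then obtain zs where zs: "replicate (length w) (Suc 0) @ [x] = zs @ w" by (auto simp: suffix_def)
  define i where "i = length w - length zs"
  have "length zs \<le> length w"
    using arg_cong[OF zs, of length] w_ne by (cases w) auto
  moreover have "w = drop (length zs) (replicate (length w) (Suc 0) @ [x])" unfolding zs by simp
  ultimately have w_eq: "w = replicate i (Suc 0) @ [x]" by (simp add: i_def)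
  \<comment> \<open>The element \<open>h\<close> has the list of a power of \<open>c\<close>, so the
    two differ only by a power of \<Delta>.\<close>
  have "?c [^] (j + i) = val (w, 0)"
    using val_st[of "?c [^] (j + i)"] pow_k[of i] w_eq by simp
  then have "h = ?c [^] (j + i) \<otimes> \<Delta> [^] p"
    using val_st[OF h] st_h by (simp add: val_def)
  moreover have "g = inv (?c [^] j0) \<otimes> h"
    using g comm_pow[of j0] by (simp add: h_def m_assoc[symmetric])
  ultimately have "g = ?c [^] (- int j0) \<otimes> (?c [^] int (j + i) \<otimes> \<Delta> [^] p)"
    by (simp only: int_pow_neg_int int_pow_int cls_closed)
  also have "\<dots> = ?c [^] (- int j0 + int (j + i)) \<otimes> \<Delta> [^] p"
    unfolding int_pow_mult[OF cls_closed] by (simp add: m_assoc)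
  finally show ?thesis by blast
qed

text \<open>The homomorphism to the integers that sends both generators to 1; it respects the braid
  relation because both sides have length \<open>m\<close>.\<close>

definition exponent_sum :: "gen sword \<Rightarrow> int" where
  "exponent_sum w = (\<Sum>s\<leftarrow>w. if snd s then 1 else - 1)"

lemma exponent_sum_simps [simp]:
  "exponent_sum [] = 0" "exponent_sum (s # w) = (if snd s then 1 else - 1) + exponent_sum w"
  "exponent_sum (u @ v) = exponent_sum u + exponent_sum v"
  "exponent_sum (pos_word cs) = int (length cs)"
  by (auto simp: exponent_sum_def) (induction cs; simp)

lemma exponent_sum_cong: "cls u = cls v \<Longrightarrow> exponent_sum u = exponent_sum v"
proof -
  have "pres_eq (dihedral_relations m) u v \<Longrightarrow> exponent_sum u = exponent_sum v"
    by (induction rule: pres_eq.induct) (auto simp: dihedral_relations_def)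
  then show "cls u = cls v \<Longrightarrow> exponent_sum u = exponent_sum v" by (simp add: pres_class_eq_iff)
qed

lemma gen_pow_eq_cls: "\<exists>ws. sigma c [^] (k::int) = cls ws \<and> exponent_sum ws = k"
proof -
  have "\<exists>ws. cls [(c, e)] [^] (i::nat) = cls ws \<and> exponent_sum ws = (if e then int i else - int i)" for e i
  proof (induction i)
    case 0
    then show ?case by (intro exI[of _ "[]"]) (simp add: one_eq)
  next
    case (Suc i)
    then obtain ws where "cls [(c, e)] [^] i = cls ws" "exponent_sum ws = (if e then int i else - int i)"
      by blast
    then show ?case by (intro exI[of _ "ws @ [(c, e)]"]) (simp add: mult_cls)
  qed
  from this[where e = "k \<ge> 0" and i = "nat \<bar>k\<bar>"]
  obtain ws where ws: "cls [(c, k \<ge> 0)] [^] nat \<bar>k\<bar> = cls ws"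
    "exponent_sum ws = (if k \<ge> 0 then int (nat \<bar>k\<bar>) else - int (nat \<bar>k\<bar>))" by blast
  have sign: "(if k \<ge> 0 then sigma c else inv (sigma c)) = cls [(c, k \<ge> 0)]"
    using inv_cls_gen[of c True] by (cases "k \<ge> 0") simp_all
  have "sigma c [^] k = cls ws"
    using int_pow_eq_nat_pow[OF cls_closed, of "[(c, True)]" k] unfolding sign ws(1) .
  moreover have "exponent_sum ws = k" using ws(2) by (simp split: if_splits)
  ultimately show ?thesis by blast
qed

lemma normalizer_eq:
  "H \<subseteq> carrier A \<Longrightarrow> normalizer A H = {g \<in> carrier A. g <# H #> inv g = H}"
  by (auto simp: normalizer_def stabilizer_def)

lemma conj_coset_eq: "g <# H #> inv g = (\<lambda>x. g \<otimes> x \<otimes> inv g) ` H"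
  by (auto simp: l_coset_def r_coset_def)

lemma generate_gen_closed: "generate A {sigma c} \<subseteq> carrier A"
  by (rule generate_incl) simp

text \<open>Conjugation by \<open>g\<close> takes \<open>sigma c\<close> to a power of itself.
  Exponent sums are invariant under conjugation, so this is the first power, and \<open>g\<close>
  commutes with \<open>sigma c\<close>.\<close>

lemma normalizer_gen_subset:
  assumes "g \<in> normalizer A (generate A {sigma c})"
  shows "\<exists>(i::int) (p::int). g = sigma c [^] i \<otimes> \<Delta> [^] p"
proof -
  let ?H = "generate A {sigma c}"
  have g: "g \<in> carrier A" "(\<lambda>x. g \<otimes> x \<otimes> inv g) ` ?H = ?H"
    using assms by (auto simp: normalizer_eq[OF generate_gen_closed] conj_coset_eq)
  have "sigma c \<in> ?H" by (auto intro: generate.incl)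
  then have "g \<otimes> sigma c \<otimes> inv g \<in> ?H" using g(2) by blast
  then obtain k :: int where "g \<otimes> sigma c \<otimes> inv g = sigma c [^] k" unfolding generate_gen_eq by blast
  then have k: "g \<otimes> sigma c = sigma c [^] k \<otimes> g" using g(1) by (metis cls_closed inv_solve_right int_pow_closed m_closed)
  obtain v ws where "g = cls v" "sigma c [^] k = cls ws" "exponent_sum ws = k"
    using g(1) gen_pow_eq_cls[of c k] by (auto simp: carrier_eq)
  then have "k = 1" using exponent_sum_cong[of "v @ [(c, True)]" "ws @ v"] k by (simp add: mult_cls)
  then show ?thesis using commutes_with_gen[OF g(1)] k by simp
qed

lemma gen_subset_normalizer: "generate A {sigma c} \<subseteq> normalizer A (generate A {sigma c})"
proof
  fix g assume g: "g \<in> generate A {sigma c}"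
  let ?H = "generate A {sigma c}"
  have sub: "subgroup ?H A" by (rule generate_is_subgroup) simp
  have gc: "g \<in> carrier A" using g generate_gen_closed by blast
  have conj_cancel: "x = g \<otimes> (inv g \<otimes> x \<otimes> g) \<otimes> inv g" if "x \<in> carrier A" for x
    using gc that by (simp add: m_assoc) (simp add: m_assoc[symmetric])
  have "x \<in> (\<lambda>x. g \<otimes> x \<otimes> inv g) ` ?H" if "x \<in> ?H" for x
  proof (rule image_eqI)
    show "inv g \<otimes> x \<otimes> g \<in> ?H"
      by (intro subgroup.m_closed[OF sub] subgroup.m_inv_closed[OF sub] g that)
    show "x = g \<otimes> (inv g \<otimes> x \<otimes> g) \<otimes> inv g"
      using that generate_gen_closed by (intro conj_cancel) blast
  qed
  then have "(\<lambda>x. g \<otimes> x \<otimes> inv g) ` ?H = ?H"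
    using g subgroup.m_closed[OF sub] subgroup.m_inv_closed[OF sub] by blast
  then show "g \<in> normalizer A ?H"
    using gc by (simp add: normalizer_eq[OF generate_gen_closed] conj_coset_eq)
qed

lemma commutes_with_generate:
  assumes z: "z \<in> carrier A" and y: "y \<in> carrier A" and comm: "z \<otimes> y = y \<otimes> z"
    and x: "x \<in> generate A {y}"
  shows "z \<otimes> x = x \<otimes> z"
  using x
proof (induction rule: generate.induct)
  case (inv h)
  then have h: "h = y" by simp
  have "inv y \<otimes> z \<otimes> y = z"
    using z y by (simp add: m_assoc comm) (simp flip: m_assoc)
  then show ?case using z y h inv_solve_right[of "inv y \<otimes> z" z y] by simp
next
  case (eng h1 h2)
  have "h1 \<in> carrier A" "h2 \<in> carrier A" using eng.hyps generate_in_carrier[of "{y}"] y by auto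
  moreover from this have "z \<otimes> (h1 \<otimes> h2) = h1 \<otimes> (z \<otimes> h2)"
    using z eng.IH(1) by (simp flip: m_assoc)
  ultimately show ?case using z eng.IH(2) by (simp add: m_assoc)
qed (use z comm in auto)

lemma garside_sq_subset_normalizer: "garside_sq_subgroup m \<subseteq> normalizer A (generate A {sigma c})"
proof
  let ?H = "generate A {sigma c}"
  fix z assume "z \<in> garside_sq_subgroup m"
  then obtain k :: int where k: "z = \<Delta> [^] (2 * k)" by (auto simp: garside_sq_subgroup_eq)
  have z: "z \<in> carrier A" by (simp add: k)
  have comm: "z \<otimes> sigma c = sigma c \<otimes> z" using garside_pow_mult_gen[of "2 * k" c] by (simp add: k twist_def)
  have "z \<otimes> x \<otimes> inv z = x" if x: "x \<in> ?H" for x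
  proof -
    have "x \<in> carrier A" using x generate_gen_closed by blast
    then show ?thesis using commutes_with_generate[OF z cls_closed comm x] z by (simp add: m_assoc)
  qed
  then have "(\<lambda>x. z \<otimes> x \<otimes> inv z) ` ?H = ?H" by force
  then show "z \<in> normalizer A ?H"
    using z by (simp add: normalizer_eq[OF generate_gen_closed] conj_coset_eq)
qed


section \<open>Unboundedness\<close>

fun changes :: "nat list \<Rightarrow> nat" where
  "changes (x # y # zs) = (if x = y then 0 else 1) + changes (y # zs)"
| "changes _ = 0"

abbreviation variation :: "state \<Rightarrow> int" where
  "variation n \<equiv> int (changes (fst n))"

lemma changes_head: "\<bar>int (changes (x # u)) - int (changes (y # u))\<bar> \<le> 1"
  by (cases u) auto

lemma changes_push: "changes (replicate (Suc k) (Suc 0) @ w) = changes (Suc 0 # w)"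
proof (induction k)
  case (Suc k)
  then show ?case by (cases k) auto
qed simp

lemma variation_push:
  assumes "n \<in> states m" "new_gen m n = c"
  shows "\<bar>variation ((step m c ^^ k) n) - variation n\<bar> \<le> 1"
proof (cases k)
  case (Suc j)
  obtain l u p where n: "n = (l # u, p)" using assms(1) by (rule states_cases) blast
  have "fst ((step m c ^^ k) n) = replicate (Suc j) (Suc 0) @ l # u"
    using funpow_step_push[of "l # u" p c k] assms(2) n Suc by simp
  then have "variation ((step m c ^^ k) n) = int (changes (Suc 0 # l # u))"
    by (simp only: changes_push)
  then show ?thesis by (simp add: n)
qed simp

text \<open>A power of \<open>c\<close> pops a run of entries \<open>m - 1\<close>, lengthens or
  wraps one entry, and pushes ones. Popping inside the run costs nothing; the end of the run, the
  altered head and the junction with the ones cost at most 1 each. Thus \<open>grow\<close> has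
  bound 2 and \<open>drop\<close> bound 3.\<close>

lemma variation_funpow_step:
  assumes "n \<in> states m"
  shows "\<bar>variation ((step m c ^^ k) n) - variation n\<bar> \<le> 3"
proof (cases "new_gen m n = c")
  case True
  then show ?thesis using variation_push[OF assms, of c k] by simp
next
  case False
  have grow: "\<bar>variation ((step m c ^^ k) (l # u, p)) - int (changes (l # u))\<bar> \<le> 2"
    if "(l # u, p) \<in> states m" "new_gen m (l # u, p) \<noteq> c" "Suc l < m" for l u p k
  proof (cases k)
    case (Suc j)
    have s: "step m c (l # u, p) = (Suc l # u, p)" using that by simp
    have "(Suc l # u, p) \<in> states m" using step_in_states[OF m_ge_3 that(1), of c] s by simp
    moreover have "new_gen m (Suc l # u, p) = c"
      using that(2) by (metis flip_flip neq_iff_eq_flip new_gen_Suc)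
    ultimately have "\<bar>variation ((step m c ^^ j) (Suc l # u, p)) - int (changes (Suc l # u))\<bar> \<le> 1"
      using variation_push[of "(Suc l # u, p)" c j] by simp
    moreover have eq: "(step m c ^^ k) (l # u, p) = (step m c ^^ j) (Suc l # u, p)"
      unfolding Suc funpow_Suc_right by (simp only: o_apply s)
    ultimately show ?thesis using changes_head[of "Suc l" u l] unfolding eq by linarith
  qed simp
  have drop: "(l # u, p) \<in> states m \<Longrightarrow> new_gen m (l # u, p) \<noteq> c \<Longrightarrow> Suc l = m \<Longrightarrow>
    \<bar>variation ((step m c ^^ k) (l # u, p)) - int (changes (l # u))\<bar> \<le> 3" for l u p k
  proof (induction u arbitrary: l p k)
    case Nil
    show ?case
    proof (cases k)
      case (Suc j)
      have s: "step m c ([l], p) = ([0], p + 1)" using Nil by simp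
      have "([0], p + 1) \<in> states m" using step_in_states[OF m_ge_3 Nil(1), of c] s by simp
      moreover have "new_gen m ([0], p + 1) = c"
        using Nil by (metis flip_flip neq_iff_eq_flip new_gen_wrap)
      ultimately have "\<bar>variation ((step m c ^^ j) ([0], p + 1))\<bar> \<le> 1"
        using variation_push[of "([0], p + 1)" c j] by simp
      moreover have "(step m c ^^ k) ([l], p) = (step m c ^^ j) ([0], p + 1)"
        unfolding Suc funpow_Suc_right by (simp only: o_apply s)
      ultimately show ?thesis by simp
    qed simp
  next
    case (Cons l' u)
    show ?case
    proof (cases k)
      case (Suc j)
      have s: "step m c (l # l' # u, p) = (l' # u, p + 1)" using Cons.prems by simp
      have in_states: "(l' # u, p + 1) \<in> states m" using step_in_states[OF m_ge_3 Cons.prems(1), of c] s by simp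
      have new: "new_gen m (l' # u, p + 1) \<noteq> c"
        using Cons.prems new_gen_drop[of l m "l' # u" p] by simp
      have eq: "(step m c ^^ k) (l # l' # u, p) = (step m c ^^ j) (l' # u, p + 1)"
        unfolding Suc funpow_Suc_right by (simp only: o_apply s)
      show ?thesis
      proof (cases "l' = l")
        case True
        then show ?thesis using Cons.IH[OF in_states new, of j] Cons.prems(3) eq by simp
      next
        case False
        then have "Suc l' < m" using in_states Cons.prems(3) by (auto simp: states_def)
        then show ?thesis using grow[OF in_states new, of j] eq False by simp
      qed
    qed simp
  qed
  obtain l u p where n: "n = (l # u, p)" "l < m" using assms by (rule states_cases) blast
  then show ?thesis
    using grow[of l u p k] drop[of l u p k] False assms by (cases "Suc l < m") auto
qed

lemma variation_gen_pow:
  assumes "n \<in> states m"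
  shows "\<bar>variation (move (sigma c [^] (k::int)) n) - variation n\<bar> \<le> 3"
proof (cases "k \<ge> 0")
  case True
  then have "sigma c [^] k = sigma c [^] nat k" by (simp flip: int_pow_int)
  then show ?thesis
    using variation_funpow_step[OF assms, of "nat k" c] move_gen_pow[OF assms, of c "nat k"] by simp
next
  case False
  define j where "j = nat (- k)"
  have j: "k = - int j" using False by (simp add: j_def)
  let ?n = "move (sigma c [^] k) n"
  have n': "?n \<in> states m" using assms by simp
  \<comment> \<open>Read from its end, a negative power is a positive one.\<close>
  have "move (sigma c [^] j) ?n = move (sigma c [^] k \<otimes> sigma c [^] j) n"
    using assms by (simp add: move_mult)
  also have "sigma c [^] k \<otimes> sigma c [^] j = \<one>"
    unfolding j by (simp add: int_pow_neg_int)
  finally have "(step m c ^^ j) ?n = n" using move_gen_pow[OF n', of c j] assms by simp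
  then show ?thesis using variation_funpow_step[OF n', of j c] by simp
qed

section \<open>Unbounded norms for \<open>X_P\<close> and for the letters with the center\<close>

lemma X_P_eq: "X_P m = (\<Union>c. {sigma c [^] k | k :: int. True}) \<union> garside_sq_subgroup m"
proof -
  have "X_P m = (\<Union>c\<in>{GenA, GenB}. generate A {sigma c}) \<union> garside_sq_subgroup m"
    by (simp add: X_P_def artin_gen_eq A_eq[symmetric])
  moreover have "{GenA, GenB} = UNIV" using gen.exhaust by blast
  ultimately show ?thesis by (simp only: generate_gen_eq)
qed

lemma gen_pow_in_X_P: "sigma c [^] (k::int) \<in> X_P m"
  unfolding X_P_eq by blast

lemma garside_pow_in_X_P: "\<Delta> [^] (2 * k :: int) \<in> X_P m"
  unfolding X_P_eq garside_sq_subgroup_eq by blast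

lemma X_P_cases:
  assumes "s \<in> X_P m"
  obtains (gen) c and k :: int where "s = sigma c [^] k" | (center) k :: int where "s = \<Delta> [^] (2 * k)"
  using assms unfolding X_P_eq garside_sq_subgroup_eq by blast

lemma inv_in_X_P:
  assumes "s \<in> X_P m"
  shows "inv s \<in> X_P m"
  using assms
proof (cases rule: X_P_cases)
  case (gen c k)
  then show ?thesis using gen_pow_in_X_P[of c "- k"] by (simp only: int_pow_neg[OF cls_closed])
next
  case (center k)
  then show ?thesis using garside_pow_in_X_P[of "- k"]
    by (simp only: int_pow_neg[OF garside_closed] mult_minus_right)
qed

lemma set_inv_X_P: "set_inv X_P m \<subseteq> X_P m"
  using inv_in_X_P by (auto simp: SET_INV_def)

lemma X_P_closed: "X_P m \<subseteq> carrier A"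
  by (auto simp: X_P_eq garside_sq_subgroup_eq)

lemma std_and_center_subset_X_P: "std_and_center \<subseteq> X_P m"
proof -
  have "sigma c = sigma c [^] (1::int)" for c by simp
  then show ?thesis unfolding std_gens_eq X_P_eq by blast
qed

lemma generating_X_P: "generating_set A (X_P m)"
  using std_and_center_subset_X_P X_P_closed by (intro generating_setI) auto

lemma std_and_center_closed: "std_and_center \<subseteq> carrier A"
  using std_and_center_subset_X_P X_P_closed by blast

lemma generating_std_and_center: "generating_set A std_and_center"
  using std_and_center_closed by (intro generating_setI) auto

lemma variation_le_X_P:
  assumes "g \<in> carrier A"
  shows "variation (st g) \<le> 3 * int (word_norm A (X_P m) g)"
proof -
  have step: "\<bar>variation (move s n) - variation n\<bar> \<le> 3" if "s \<in> X_P m" "n \<in> states m" for s n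
    using that(1)
  proof (cases rule: X_P_cases)
    case (gen c k)
    then show ?thesis using variation_gen_pow[OF that(2)] by (simp only:)
  next
    case (center k)
    then show ?thesis using move_garside_pow[of "fst n" "snd n" "2 * k"] that(2) by simp
  qed
  have "set ws \<subseteq> X_P m \<Longrightarrow> n \<in> states m \<Longrightarrow>
      \<bar>variation (move (foldr (\<otimes>) ws \<one>) n) - variation n\<bar> \<le> 3 * int (length ws)" for ws n
  proof (induction ws arbitrary: n)
    case (Cons s ws)
    have "set ws \<subseteq> carrier A" "s \<in> carrier A" using Cons.prems(1) X_P_closed by auto
    then have "move (foldr (\<otimes>) (s # ws) \<one>) n = move (foldr (\<otimes>) ws \<one>) (move s n)"
      using Cons.prems(2) by (simp add: move_mult foldr_mult_closed)
    then show ?case using Cons.IH[of "move s n"] Cons.prems step[of s n] by simp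
  qed simp
  moreover obtain ws where "set ws \<subseteq> X_P m \<union> set_inv X_P m" "length ws = word_norm A (X_P m) g"
    "foldr (\<otimes>) ws \<one> = g" using word_norm_attained[OF generating_X_P assms] .
  moreover have "X_P m \<union> set_inv X_P m = X_P m" using set_inv_X_P by blast
  ultimately have "\<bar>variation (st g) - variation base\<bar> \<le> 3 * int (word_norm A (X_P m) g)"
    using base_in_states by metis
  then show ?thesis by simp
qed

text \<open>The letters \<open>x\<close>, \<open>x\<close>, \<open>flip x\<close> append the entries
  1 and 2, which creates a new change whatever the previous head was. The entry 2 requires
  \<open>m \<ge> 3\<close>.\<close>

lemma variation_unbounded: "\<exists>g\<in>carrier A. variation (st g) \<ge> int N"
proof (induction N)
  case 0
  then show ?case by (intro bexI[of _ \<one>]) auto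
next
  case (Suc N)
  then obtain g where g: "g \<in> carrier A" "variation (st g) \<ge> int N" by blast
  have "st g \<in> states m" by simp
  then obtain l u p where lup: "st g = (l # u, p)" by (rule states_cases) blast
  then have in_states: "(l # u, p) \<in> states m" using \<open>st g \<in> states m\<close> by simp
  define x where "x = new_gen m (l # u, p)"
  have "changes (Suc 0 # l # u) \<ge> changes (l # u)" by simp
  moreover have "st (g \<otimes> pos [x, x, flip x]) = (2 # Suc 0 # l # u, p)"
    using g m_ge_3 lup in_states x_def move_pos[of "st g" "[x, x, flip x]"] by (simp add: move_mult numeral_2_eq_2)
  ultimately show ?case using g lup by (intro bexI[of _ "g \<otimes> pos [x, x, flip x]"]) auto
qed

lemma X_P_unbounded: "\<exists>g\<in>carrier A. word_norm A (X_P m) g \<ge> N"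
proof -
  obtain g where "g \<in> carrier A" "variation (st g) \<ge> int (3 * N)" using variation_unbounded by blast
  then show ?thesis using variation_le_X_P[of g] by (intro bexI[of _ g]) linarith
qed

text \<open>The set \<open>X_P\<close> is the smallest of the four in the order, so unboundedness of
  its norm passes to all of them.\<close>

lemma ediameter_infinite_if_gen_le:
  assumes X: "generating_set A X" and le: "gen_le A (X_P m) X"
  shows "ediameter (word_metric A X) = \<infinity>"
proof (rule ediameter_word_metric_infinite[OF X])
  fix N
  obtain C where C: "\<forall>y\<in>X. word_norm A (X_P m) y \<le> C"
    using le gen_le_iff[OF generating_X_P X] by blast
  obtain g where g: "g \<in> carrier A" "word_norm A (X_P m) g \<ge> Suc (C * N)" using X_P_unbounded by blast
  have "C * word_norm A X g \<ge> word_norm A (X_P m) g"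
    using word_norm_le_if_gens_le[OF generating_X_P X _ g(1)] C by blast
  then have "C * N < C * word_norm A X g" using g(2) by linarith
  then show "\<exists>g\<in>carrier A. word_norm A X g \<ge> N" using g(1) by (intro bexI[of _ g]) auto
qed

text \<open>A small step adds at most one entry; the summand 1 is the length of the list of
  \<open>base\<close>.\<close>

lemma length_le_std_and_center:
  assumes "g \<in> carrier A"
  shows "length (fst (st g)) \<le> 1 + word_norm A std_and_center g"
proof -
  have len: "set ws \<subseteq> small_steps \<Longrightarrow> length (fst (st (foldr (\<otimes>) ws \<one>))) \<le> 1 + length ws" for ws
  proof (induction ws rule: rev_induct)
    case (snoc y ws)
    let ?g = "foldr (\<otimes>) ws \<one>"
    have c: "set ws \<subseteq> carrier A" "y \<in> carrier A" using snoc.prems small_steps_closed by auto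
    have "foldr (\<otimes>) (ws @ [y]) \<one> = ?g \<otimes> y" using foldr_mult_append[of ws "[y]"] c by simp
    then have "st (foldr (\<otimes>) (ws @ [y]) \<one>) = move y (st ?g)"
      using c foldr_mult_closed[OF c(1)] by (simp add: move_mult)
    moreover have "length (tl (fst (move y (st ?g)))) \<le> length (fst (st ?g))"
      using small_step_suffix(1)[of y "st ?g"] snoc.prems by (intro suffix_length_le) auto
    ultimately show ?case using snoc by simp
  qed simp
  obtain ws where ws: "set ws \<subseteq> std_and_center \<union> set_inv std_and_center"
    "length ws = word_norm A std_and_center g" "foldr (\<otimes>) ws \<one> = g"
    using word_norm_attained[OF generating_std_and_center assms] .
  have "std_and_center \<union> set_inv std_and_center \<subseteq> small_steps"
  proof -
    have "inv (\<Delta> [^] (2 * k)) \<in> garside_sq_subgroup m" for k :: int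
      unfolding garside_sq_subgroup_eq int_pow_neg[OF garside_closed, symmetric] mult_minus_right[symmetric]
      by blast
    then have "inv y \<in> small_steps" if "y \<in> std_and_center" for y
      using that inv_cls_gen[of _ True] by (auto simp: garside_sq_subgroup_eq std_gens_eq small_steps_def)
    then show ?thesis by (auto simp: SET_INV_def small_steps_def std_gens_eq)
  qed
  then have "set ws \<subseteq> small_steps" using ws(1) by blast
  then show ?thesis using len[of ws] ws by simp
qed

section \<open>Infimum, supremum and absorbable elements\<close>

lemma artin_pos_eq: "artin_pos m = range pos"
proof
  show "artin_pos m \<subseteq> range pos"
  proof
    fix x assume "x \<in> artin_pos m"
    then show "x \<in> range pos"
      unfolding artin_pos_def A_eq[symmetric]
    proof (induction rule: monoid_generate.induct)
      case one
      show ?case by (rule image_eqI[where x = "[]"]) (simp_all add: one_eq)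
    next
      case (incl s)
      then obtain c where "s = sigma c" by (auto simp: std_gens_eq)
      then show ?case by (intro image_eqI[where x = "[c]"]) simp_all
    next
      case (mult x y)
      then obtain cs ds where "x = pos cs" "y = pos ds" by blast
      then show ?case by (intro image_eqI[where x = "cs @ ds"]) (simp_all add: mult_cls)
    qed
  qed
  have "pos cs \<in> monoid_generate A (std_gens m)" for cs
  proof (induction cs)
    case Nil
    then show ?case using monoid_generate.one[of A] by (simp add: one_eq)
  next
    case (Cons c cs)
    have "sigma c \<in> monoid_generate A (std_gens m)"
      by (rule monoid_generate.incl) (simp add: std_gens_eq)
    then have "sigma c \<otimes> pos cs \<in> monoid_generate A (std_gens m)"
      using Cons.IH by (rule monoid_generate.mult)
    then show ?case by (simp add: mult_cls)
  qed
  then show "range pos \<subseteq> artin_pos m" by (auto simp: artin_pos_def A_eq[symmetric])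
qed

lemma garside_pow_mult_pos: "\<Delta> [^] (k::int) \<otimes> pos cs = pos (map (twist k) cs) \<otimes> \<Delta> [^] k"
proof (induction cs)
  case Nil
  then show ?case by (simp flip: one_eq)
next
  case (Cons c cs)
  have "\<Delta> [^] k \<otimes> pos (c # cs) = (\<Delta> [^] k \<otimes> pos [c]) \<otimes> pos cs"
    using mult_cls[of "pos_word [c]" "pos_word cs"] by (simp add: m_assoc)
  also have "\<dots> = pos [twist k c] \<otimes> (\<Delta> [^] k \<otimes> pos cs)"
    unfolding garside_pow_mult_gen by (simp add: m_assoc)
  also have "\<dots> = (pos [twist k c] \<otimes> pos (map (twist k) cs)) \<otimes> \<Delta> [^] k"
    unfolding Cons.IH by (simp add: m_assoc)
  finally show ?case by (simp add: mult_cls)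
qed

lemma garside_pow_pos: "k \<ge> 0 \<Longrightarrow> \<exists>cs. \<Delta> [^] (k::int) = pos cs"
proof (induction k rule: int_ge_induct)
  case base
  then show ?case using one_eq by (intro exI[of _ "[]"]) simp
next
  case (step k)
  then obtain cs where "\<Delta> [^] k = pos cs" by blast
  then have "\<Delta> [^] (k + 1) = pos (cs @ alt_word GenA GenB m)"
    using int_pow_mult[of \<Delta> k 1] garside_eq[of GenA] by (simp add: mult_cls)
  then show ?case by blast
qed

lemma pos_mult_garside_pow: "k \<ge> 0 \<Longrightarrow> pos cs \<otimes> \<Delta> [^] (k::int) \<in> artin_pos m"
proof -
  assume "k \<ge> 0"
  then obtain ds where "\<Delta> [^] k = pos ds" using garside_pow_pos by blast
  then show ?thesis
    unfolding artin_pos_eq by (intro image_eqI[where x = "cs @ ds"]) (simp_all add: mult_cls)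
qed

text \<open>The supremum of the element encoded by a state: the first factor may be empty.\<close>

definition sup_state :: "state \<Rightarrow> int" where
  "sup_state n = snd n + int (length (fst n)) - (if last (fst n) = 0 then 1 else 0)"

text \<open>Opening a factor raises the supremum and completing one raises the infimum. If neither
  changes, the letter has lengthened the head.\<close>

lemma step_inf_sup:
  assumes "n \<in> states m"
  shows "snd n \<le> snd (step m c n)" "sup_state n \<le> sup_state (step m c n)"
    "snd (step m c n) = snd n \<Longrightarrow> sup_state (step m c n) = sup_state n \<Longrightarrow>
      hd (fst (step m c n)) = Suc (hd (fst n))"
proof -
  obtain l u p where n: "n = (l # u, p)" using assms by (rule states_cases) blast
  show "snd n \<le> snd (step m c n)" "sup_state n \<le> sup_state (step m c n)"
    "snd (step m c n) = snd n \<Longrightarrow> sup_state (step m c n) = sup_state n \<Longrightarrow>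
      hd (fst (step m c n)) = Suc (hd (fst n))"
    unfolding n by (auto simp: sup_state_def split: if_splits)
qed

lemma fold_step_inf_sup:
  assumes "n \<in> states m"
  shows "snd n \<le> snd (fold (step m) cs n) \<and> sup_state n \<le> sup_state (fold (step m) cs n) \<and>
    (snd (fold (step m) cs n) = snd n \<longrightarrow> sup_state (fold (step m) cs n) = sup_state n \<longrightarrow>
      hd (fst (fold (step m) cs n)) = hd (fst n) + length cs)"
  using assms
proof (induction cs arbitrary: n)
  case (Cons c cs)
  then show ?case using Cons.IH[OF step_in_states[OF m_ge_3 Cons.prems, of c]] step_inf_sup[OF Cons.prems, of c]
    by auto
qed simp

text \<open>Completing the factors from the last to the first turns each of them into a \<Delta>. An
  empty first factor needs no completion, whence the correction in \<open>sup_state\<close>.\<close>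

lemma fold_step_to_garside_pow:
  "(l # u, p) \<in> states m \<Longrightarrow> \<exists>cs. fold (step m) cs (l # u, p) = ([0], sup_state (l # u, p))"
proof (induction u arbitrary: l p)
  case Nil
  show ?case
  proof (cases "l = 0")
    case True
    then show ?thesis by (intro exI[of _ "[]"]) (simp add: sup_state_def)
  next
    case False
    let ?c = "flip (new_gen m ([l], p))"
    have "fold (step m) (alt_word ?c (flip ?c) (m - l)) ([l], p) = ([0], p + 1)"
      using fold_step_complete[of l m ?c "[]" p] Nil by (simp add: states_def)
    then show ?thesis using False unfolding sup_state_def by auto
  qed
next
  case (Cons l' u)
  let ?c = "flip (new_gen m (l # l' # u, p))"
  have "fold (step m) (alt_word ?c (flip ?c) (m - l)) (l # l' # u, p) = (l' # u, p + 1)"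
    using fold_step_complete[of l m ?c "l' # u" p] Cons.prems by (simp add: states_def)
  moreover obtain cs where "fold (step m) cs (l' # u, p + 1) = ([0], sup_state (l' # u, p + 1))"
    using Cons by (auto simp: states_def)
  moreover have "sup_state (l' # u, p + 1) = sup_state (l # l' # u, p)"
    by (simp add: sup_state_def)
  ultimately show ?case
    by (intro exI[of _ "alt_word ?c (flip ?c) (m - l) @ cs"]) simp
qed

lemma st_garside_pow: "st (\<Delta> [^] (k::int)) = ([0], k)"
  by (simp add: move_garside_pow)

text \<open>Positive letters never lower the exponent, so no larger power of \<Delta> can be split
  off. Conversely the negative power passes through the factors, which at most exchanges letters,
  and is compensated by the exponent.\<close>

lemma inf_iff:
  fixes k :: int
  assumes x: "x \<in> carrier A"
  shows "\<Delta> [^] (- k) \<otimes> x \<in> artin_pos m \<longleftrightarrow> k \<le> snd (st x)"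
proof
  assume "\<Delta> [^] (- k) \<otimes> x \<in> artin_pos m"
  then obtain cs where "\<Delta> [^] (- k) \<otimes> x = pos cs" by (auto simp: artin_pos_eq)
  then have "\<Delta> [^] k \<otimes> pos cs = x"
    using x by (simp add: int_pow_neg m_assoc[symmetric] flip: \<open>_ = pos cs\<close>)
  moreover have "([0], k) \<in> states m" using m_ge_3 by (simp add: states_def)
  moreover have "st (\<Delta> [^] k \<otimes> pos cs) = move (pos cs) (st (\<Delta> [^] k))" by (rule move_mult) simp_all
  ultimately have "st x = fold (step m) cs ([0], k)" by (simp add: st_garside_pow move_pos)
  moreover have "([0], k) \<in> states m" using m_ge_3 by (simp add: states_def)
  ultimately show "k \<le> snd (st x)" using fold_step_inf_sup[of "([0], k)" cs] by simp
next
  assume k: "k \<le> snd (st x)"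
  let ?w = "nf_word m (fst (st x))" and ?p = "snd (st x)"
  have "\<Delta> [^] (- k) \<otimes> x = \<Delta> [^] (- k) \<otimes> (pos ?w \<otimes> \<Delta> [^] ?p)"
    using val_st[OF x] by (simp add: val_def)
  also have "\<dots> = \<Delta> [^] (- k) \<otimes> pos ?w \<otimes> \<Delta> [^] ?p" by (simp add: m_assoc)
  also have "\<dots> = pos (map (twist (- k)) ?w) \<otimes> \<Delta> [^] (- k + ?p)"
    unfolding garside_pow_mult_pos int_pow_mult[OF garside_closed] by (simp add: m_assoc)
  finally show "\<Delta> [^] (- k) \<otimes> x \<in> artin_pos m"
    using pos_mult_garside_pow k by simp
qed

text \<open>Positive letters never lower \<open>sup_state\<close>, which is \<open>k\<close> at the
  state of the \<open>k\<close>-th power of \<Delta>. Conversely the word that completes all factors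
  reaches the least such power, and further factors \<Delta> are positive.\<close>

lemma sup_iff:
  fixes k :: int
  assumes x: "x \<in> carrier A"
  shows "inv x \<otimes> \<Delta> [^] k \<in> artin_pos m \<longleftrightarrow> sup_state (st x) \<le> k"
proof
  assume "inv x \<otimes> \<Delta> [^] k \<in> artin_pos m"
  then obtain cs where cs: "inv x \<otimes> \<Delta> [^] k = pos cs" by (auto simp: artin_pos_eq)
  have "x \<otimes> pos cs = \<Delta> [^] k" unfolding cs[symmetric] using x by (simp add: m_assoc[symmetric])
  moreover have "st (x \<otimes> pos cs) = move (pos cs) (st x)" using x by (intro move_mult) simp_all
  ultimately have "fold (step m) cs (st x) = ([0], k)"
    using st_garside_pow[of k] move_in_states[OF base_in_states, of x] by (simp add: move_pos)
  then show "sup_state (st x) \<le> k"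
    using fold_step_inf_sup[of "st x" cs] by (simp add: sup_state_def)
next
  assume k: "sup_state (st x) \<le> k"
  have sx: "st x \<in> states m" by simp
  then obtain l u p where "st x = (l # u, p)" by (rule states_cases) blast
  then obtain cs where cs: "fold (step m) cs (st x) = ([0], sup_state (st x))"
    using fold_step_to_garside_pow sx by metis
  have "st (x \<otimes> pos cs) = st (\<Delta> [^] sup_state (st x))"
    using cs x by (simp add: move_mult move_pos st_garside_pow)
  then have "x \<otimes> pos cs = \<Delta> [^] sup_state (st x)" using x by (intro st_inj) auto
  then have "pos cs = inv x \<otimes> \<Delta> [^] sup_state (st x)"
    using x by (simp add: m_assoc[symmetric] flip: \<open>_ = \<Delta> [^] sup_state (st x)\<close>)
  moreover have "\<Delta> [^] k = \<Delta> [^] sup_state (st x) \<otimes> \<Delta> [^] (k - sup_state (st x))"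
    using int_pow_mult[of \<Delta> "sup_state (st x)" "k - sup_state (st x)"] by simp
  ultimately have "inv x \<otimes> \<Delta> [^] k = pos cs \<otimes> \<Delta> [^] (k - sup_state (st x))"
    using x by (simp add: m_assoc)
  then show "inv x \<otimes> \<Delta> [^] k \<in> artin_pos m"
    using pos_mult_garside_pow k by simp
qed

lemma artin_inf_eq: "x \<in> carrier A \<Longrightarrow> artin_inf m x = snd (st x)"
  unfolding artin_inf_def A_eq[symmetric] by (rule Greatest_equality) (simp_all add: inf_iff)

lemma artin_sup_eq: "x \<in> carrier A \<Longrightarrow> artin_sup m x = sup_state (st x)"
  unfolding artin_sup_def A_eq[symmetric] by (rule Least_equality) (simp_all add: sup_iff)

text \<open>Multiplying by a positive letter without changing infimum and supremum lengthens the last factor.\<close>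

lemma positive_absorbed_short:
  assumes x: "x \<in> carrier A" and inf: "artin_inf m (x \<otimes> pos cs) = artin_inf m x"
    and sup: "artin_sup m (x \<otimes> pos cs) = artin_sup m x"
  shows "length cs < m"
proof -
  have n: "st x \<in> states m" "st (x \<otimes> pos cs) \<in> states m" by simp_all
  have eq: "st (x \<otimes> pos cs) = fold (step m) cs (st x)"
    using x by (simp add: move_mult move_pos)
  have "hd (fst (st (x \<otimes> pos cs))) = hd (fst (st x)) + length cs"
    using fold_step_inf_sup[OF n(1), of cs] inf sup x by (simp add: artin_inf_eq artin_sup_eq eq)
  moreover have "hd (fst (st (x \<otimes> pos cs))) < m"
    using n(2) by (rule states_cases) auto
  ultimately show ?thesis by simp
qed

lemma inv_cls: "\<exists>vs. inv (cls ws) = cls vs \<and> length vs = length ws"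
proof (intro exI conjI)
  have "cls (inv_sword ws) \<otimes> cls ws = \<one>"
    using pres_eq_inv_sword by (simp add: mult_cls one_eq pres_class_eq_iff)
  then show "inv (cls ws) = cls (inv_sword ws)" by (intro inv_equality) auto
qed (simp add: inv_sword_def)

text \<open>Infimum 0 makes \<open>y\<close> positive, and \<open>x\<close> absorbs it. Supremum 0
  makes the inverse of \<open>y\<close> positive, and \<open>x \<otimes> y\<close> absorbs this
  inverse, with product \<open>x\<close>.\<close>

lemma absorbable_short:
  assumes "absorbable m y"
  shows "\<exists>ws. y = cls ws \<and> length ws < m"
proof -
  obtain x where y: "y \<in> carrier A" and x: "x \<in> carrier A" and
    eqs: "artin_inf m (x \<otimes> y) = artin_inf m x" "artin_sup m (x \<otimes> y) = artin_sup m x" and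
    zero: "artin_inf m y = 0 \<or> artin_sup m y = 0"
    using assms by (auto simp: absorbable_def A_eq[symmetric])
  from zero show ?thesis
  proof
    assume "artin_inf m y = 0"
    then have "\<Delta> [^] (- 0 :: int) \<otimes> y \<in> artin_pos m"
      using y by (subst inf_iff) (auto simp: artin_inf_eq)
    then obtain cs where cs: "y = pos cs" using y by (auto simp: artin_pos_eq)
    then show ?thesis using positive_absorbed_short[OF x] eqs by (intro exI[of _ "pos_word cs"]) (simp add: pos_word_def)
  next
    assume "artin_sup m y = 0"
    then have "inv y \<otimes> \<Delta> [^] (0 :: int) \<in> artin_pos m"
      using y by (subst sup_iff) (auto simp: artin_sup_eq)
    then obtain cs where cs: "inv y = pos cs" using y by (auto simp: artin_pos_eq)
    have "(x \<otimes> y) \<otimes> pos cs = x" using x y by (simp add: m_assoc flip: cs)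
    then have "length cs < m" using positive_absorbed_short[of "x \<otimes> y" cs] eqs x y by simp
    moreover have "y = inv (pos cs)" using y by (simp flip: cs)
    ultimately show ?thesis using inv_cls[of "pos_word cs"] by (metis length_map pos_word_def)
  qed
qed

text \<open>The other generator absorbs \<open>sigma c\<close>: the product of the two is still a
  single factor, of length 2 < \<open>m\<close>.\<close>

lemma absorbable_gen: "absorbable m (sigma c)"
proof -
  have st_gen: "st (sigma d) = step m d base" for d
    using move_pos[of base "[d]"] by simp
  have st_gen2: "st (sigma d \<otimes> sigma e) = step m e (step m d base)" for d e
    using move_pos[of base "[d, e]"] by (simp add: mult_cls)
  have "artin_inf m (sigma c) = 0"
    using m_ge_3 by (cases c) (simp_all add: artin_inf_eq st_gen new_gen_def)
  moreover have "artin_inf m (sigma (flip c) \<otimes> sigma c) = artin_inf m (sigma (flip c))"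
      "artin_sup m (sigma (flip c) \<otimes> sigma c) = artin_sup m (sigma (flip c))"
    using m_ge_3 by (cases c; simp add: artin_inf_eq artin_sup_eq st_gen st_gen2 new_gen_def sup_state_def)+
  ultimately show ?thesis
    unfolding absorbable_def A_eq[symmetric] by (intro conjI disjI1 bexI[of _ "sigma (flip c)"]) simp_all
qed


section \<open>Comparison of the four generating sets\<close>

lemma X_NP_eq: "X_NP m = (\<Union>c. normalizer A (generate A {sigma c}))"
proof -
  have "X_NP m = (\<Union>c\<in>{GenA, GenB}. normalizer A (generate A {sigma c}))"
    by (simp add: X_NP_def artin_gen_eq A_eq[symmetric])
  moreover have "{GenA, GenB} = UNIV" using gen.exhaust by blast
  ultimately show ?thesis by simp
qed

lemma X_NP_cases:
  assumes "s \<in> X_NP m"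
  obtains c and i p :: int where "s = sigma c [^] i \<otimes> \<Delta> [^] p"
  using assms normalizer_gen_subset unfolding X_NP_eq by blast

lemma generate_gen_subset_X_NP: "generate A {sigma c} \<subseteq> X_NP m"
  using gen_subset_normalizer unfolding X_NP_eq by blast

lemma X_P_subset_X_NP: "X_P m \<subseteq> X_NP m"
  using gen_subset_normalizer garside_sq_subset_normalizer
  unfolding X_P_eq X_NP_eq generate_gen_eq by blast

lemma X_NP_closed: "X_NP m \<subseteq> carrier A"
  by (auto elim!: X_NP_cases)

lemma generating_X_NP: "generating_set A (X_NP m)"
  using std_and_center_subset_X_P X_P_subset_X_NP X_NP_closed by (intro generating_setI) auto

lemma std_and_center_subset_X_abs: "std_and_center \<subseteq> X_abs m"
  using absorbable_gen by (auto simp: X_abs_def std_gens_eq)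

lemma X_abs_closed: "X_abs m \<subseteq> carrier A"
  using std_and_center_closed by (auto simp: X_abs_def absorbable_def A_eq)

lemma generating_X_abs: "generating_set A (X_abs m)"
  using std_and_center_subset_X_abs X_abs_closed by (intro generating_setI) auto

lemma gen_le_if_subset:
  assumes "generating_set A X" "generating_set A Y" "Y \<subseteq> X"
  shows "gen_le A X Y"
  using assms word_norm_gen_le_1[of X] by (subst gen_le_iff) (auto simp: generating_set_def)

lemma X_P_le_X_NP: "gen_le A (X_P m) (X_NP m)"
proof -
  \<comment> \<open>One for the power of the generator and \<open>m + 1\<close> for the power of
    \<Delta>.\<close>
  have "word_norm A (X_P m) y \<le> m + 2" if y: "y \<in> X_NP m" for y
  proof -
    obtain c and i p :: int where y: "y = sigma c [^] i \<otimes> \<Delta> [^] p" using y by (rule X_NP_cases)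
    have "word_norm A (X_P m) (sigma c [^] i) \<le> 1"
      using gen_pow_in_X_P X_P_closed by (intro word_norm_gen_le_1) auto
    moreover have "word_norm A (X_P m) (\<Delta> [^] p) \<le> 1 * (m + 1)"
      by (intro word_norm_garside_pow_le[OF generating_X_P]
          small_step_norm_le_1[OF std_and_center_subset_X_P X_P_closed])
    ultimately show ?thesis
      unfolding y using word_norm_mult_le[OF generating_X_P, of "sigma c [^] i" "\<Delta> [^] p"] by simp
  qed
  then show ?thesis using gen_le_iff[OF generating_X_P generating_X_NP] by blast
qed

lemma std_and_center_le_X_abs: "gen_le A std_and_center (X_abs m)"
proof -
  have small: "word_norm A std_and_center y \<le> 1" if "y \<in> small_steps" for y
    using that by (intro small_step_norm_le_1[OF _ std_and_center_closed]) auto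
  have "word_norm A std_and_center y \<le> m" if y: "y \<in> X_abs m" for y
  proof (cases "y \<in> garside_sq_subgroup m")
    case True
    then show ?thesis using small[of y] m_ge_3 by (simp add: small_steps_def)
  next
    case False
    then obtain ws where ws: "y = cls ws" "length ws < m"
      using y absorbable_short by (auto simp: X_abs_def)
    have "refinable std_and_center (1 * length ws) (cls ws)"
      by (rule refinable_cls[OF generating_std_and_center small])
    then obtain vs where "foldr (\<otimes>) vs \<one> = cls ws"
      "word_norm A std_and_center (foldr (\<otimes>) (take (length vs) vs) \<one>) \<le> 1 * length ws"
      unfolding refinable_def by blast
    then show ?thesis using ws by simp
  qed
  then show ?thesis using gen_le_iff[OF generating_std_and_center generating_X_abs] by blast
qed

lemma not_std_and_center_le_X_P: "\<not> gen_le A std_and_center (X_P m)"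
proof
  assume "gen_le A std_and_center (X_P m)"
  then obtain C where C: "\<forall>y\<in>X_P m. word_norm A std_and_center y \<le> C"
    using gen_le_iff[OF generating_std_and_center generating_X_P] by blast
  \<comment> \<open>At \<open>base\<close> it is \<open>GenA\<close> that opens factors, so each of
    the \<open>Suc C\<close> letters adds an entry to the list \<open>[0]\<close>, and the norm is
    at least \<open>Suc C\<close>.\<close>
  let ?g = "sigma GenA [^] Suc C"
  have "?g = sigma GenA [^] int (Suc C)" by (simp only: int_pow_int)
  then have "?g \<in> X_P m" using gen_pow_in_X_P by metis
  then have "word_norm A std_and_center ?g \<le> C" using C by blast
  moreover have "st ?g = (replicate (Suc C) (Suc 0) @ [0], 0)"
    using move_gen_pow[OF base_in_states, of GenA "Suc C"] funpow_step_push[of "[0]" 0 GenA "Suc C"]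
    by (simp only: new_gen_def) simp
  then have "length (fst (st ?g)) = Suc C + 1" by simp
  ultimately show False using length_le_std_and_center[of ?g] by simp
qed

lemma hyperbolic_X_P: "hyperbolic_structure A (X_P m)"
proof (rule hyperbolic_structure_if_refinable[OF generating_X_P, where C = "m + 1"])
  have small: "word_norm A (X_P m) y \<le> 1" if "y \<in> small_steps" for y
    using small_step_norm_le_1[OF std_and_center_subset_X_P X_P_closed that] .
  then show "word_norm A (X_P m) y \<le> m + 1" if "y \<in> small_steps" for y using that by fastforce
  have "refinable (X_P m) (m + 1) s" if "s \<in> X_P m" for s
    using that
  proof (cases rule: X_P_cases)
    case (gen c k)
    have "generate A {sigma c} \<subseteq> X_P m" by (auto simp: generate_gen_eq gen_pow_in_X_P)
    then show ?thesis
      unfolding gen by (intro refinable_mono[OF refinable_gen_pow[OF generating_X_P]]) auto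
  next
    case (center k)
    then show ?thesis using refinable_garside_pow[OF generating_X_P small, of "2 * k"] by simp
  qed
  moreover have "X_P m \<union> set_inv X_P m = X_P m" using set_inv_X_P by blast
  ultimately show "\<exists>ws. set ws \<subseteq> small_steps \<and> foldr (\<otimes>) ws \<one> = s \<and>
      (\<forall>i. word_norm A (X_P m) (foldr (\<otimes>) (take i ws) \<one>) \<le> m + 1)"
    if "s \<in> X_P m \<union> set_inv X_P m" for s
    using that unfolding refinable_def by simp
qed

lemma hyperbolic_X_NP: "hyperbolic_structure A (X_NP m)"
\<comment> \<open>The bounds 1 for powers of a generator and \<open>m + 1\<close> for powers of
  \<Delta> add up along the product.\<close>
proof (rule hyperbolic_structure_if_refinable[OF generating_X_NP, where C = "m + 2"])
  have small: "word_norm A (X_NP m) y \<le> 1" if "y \<in> small_steps" for y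
    using small_step_norm_le_1[OF _ X_NP_closed that] std_and_center_subset_X_P X_P_subset_X_NP by blast
  then show "word_norm A (X_NP m) y \<le> m + 2" if "y \<in> small_steps" for y using that by fastforce
  note gen = refinable_gen_pow[OF generating_X_NP generate_gen_subset_X_NP]
  have center: "refinable (X_NP m) (m + 1) (\<Delta> [^] p)" for p :: int
    using refinable_garside_pow[OF generating_X_NP small] by simp
  have "refinable (X_NP m) (m + 2) s \<and> refinable (X_NP m) (m + 2) (inv s)" if s_in: "s \<in> X_NP m" for s
  proof -
    obtain c and i p :: int where s: "s = sigma c [^] i \<otimes> \<Delta> [^] p" using s_in by (rule X_NP_cases)
    then have inv_s: "inv s = \<Delta> [^] (- p) \<otimes> sigma c [^] (- i)"
      by (simp add: inv_mult_group int_pow_neg)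
    show ?thesis
      unfolding inv_s using refinable_mult[OF generating_X_NP gen[of c i] center[of p]]
        refinable_mult[OF generating_X_NP center[of "- p"] gen[of c "- i"]] by (simp add: s)
  qed
  then show "\<exists>ws. set ws \<subseteq> small_steps \<and> foldr (\<otimes>) ws \<one> = s \<and>
      (\<forall>i. word_norm A (X_NP m) (foldr (\<otimes>) (take i ws) \<one>) \<le> m + 2)"
    if "s \<in> X_NP m \<union> set_inv X_NP m" for s
    using that unfolding refinable_def[symmetric] by (auto simp: SET_INV_def)
qed

text \<open>The common case of \<open>X_abs\<close> and of the letters with the center: a generator
  outside the center can be refined letter by letter, in fewer than \<open>m\<close> steps.\<close>

lemma hyperbolic_if_short:
  assumes std: "std_and_center \<subseteq> X" and X: "X \<subseteq> carrier A"
    and short: "\<And>s. s \<in> X \<Longrightarrow> s \<in> garside_sq_subgroup m \<or> (\<exists>ws. s = cls ws \<and> length ws < m)"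
  shows "hyperbolic_structure A X"
proof -
  have gen: "generating_set A X" using std X by (intro generating_setI) auto
  have small: "word_norm A X y \<le> 1" if "y \<in> small_steps" for y
    using small_step_norm_le_1[OF std X that] .
  have word: "refinable X m (cls ws)" if "length ws < m" for ws
    using refinable_mono[OF refinable_cls[OF gen small], of ws m] that by simp
  have center: "refinable X (m + 1) (\<Delta> [^] p)" for p :: int
    using refinable_garside_pow[OF gen small] by simp
  have "refinable X (m + 1) s \<and> refinable X (m + 1) (inv s)" if "s \<in> X" for s
    using short[OF that]
  proof
    assume "s \<in> garside_sq_subgroup m"
    then obtain k :: int where "s = \<Delta> [^] (2 * k)" by (auto simp: garside_sq_subgroup_eq)
    then show ?thesis using center[of "2 * k"] center[of "- (2 * k)"] by (simp add: int_pow_neg)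
  next
    assume "\<exists>ws. s = cls ws \<and> length ws < m"
    then obtain ws vs where "s = cls ws" "length ws < m" "inv s = cls vs" "length vs < m"
      using inv_cls by metis
    then show ?thesis using word[of ws] word[of vs] refinable_mono[of X m _ "m + 1"] by simp
  qed
  then show ?thesis
    using small
    by (intro hyperbolic_structure_if_refinable[OF gen, where C = "m + 1"])
      (fastforce simp: refinable_def[symmetric] SET_INV_def intro: order.trans)+
qed

lemma hyperbolic_X_abs: "hyperbolic_structure A (X_abs m)"
  using absorbable_short
  by (intro hyperbolic_if_short std_and_center_subset_X_abs X_abs_closed) (auto simp: X_abs_def)

lemma hyperbolic_std_and_center: "hyperbolic_structure A std_and_center"
proof (intro hyperbolic_if_short std_and_center_closed order.refl)
  fix s assume "s \<in> std_and_center"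
  then show "s \<in> garside_sq_subgroup m \<or> (\<exists>ws. s = cls ws \<and> length ws < m)"
    using m_ge_3 by (fastforce simp: std_gens_eq intro: exI[of _ "[(c, True)]" for c])
qed

end

theorem proposition4p8:
  fixes m :: nat
  assumes "m \<ge> 3"
  shows "gen_equiv (artin m) (X_P m) (X_NP m)
    \<and> gen_le (artin m) (X_NP m) (X_abs m)
    \<and> \<not> gen_le (artin m) (X_abs m) (X_NP m)
    \<and> gen_equiv (artin m) (X_abs m) (std_gens m \<union> garside_sq_subgroup m)
    \<and> (\<forall>X \<in> {X_P m, X_NP m, X_abs m, std_gens m \<union> garside_sq_subgroup m}.
          hyperbolic_structure (artin m) X \<and> ediameter (word_metric (artin m) X) = \<infinity>)"
proof -
  interpret dihedral_artin "artin m" m using assms by (rule dihedral_artin_artin)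
  let ?S = "std_gens m \<union> garside_sq_subgroup m"
  note gens = generating_X_P generating_X_NP generating_X_abs generating_std_and_center
  have NP_P: "gen_le (artin m) (X_NP m) (X_P m)"
    using X_P_subset_X_NP by (intro gen_le_if_subset gens)
  have P_S: "gen_le (artin m) (X_P m) ?S"
    using std_and_center_subset_X_P by (intro gen_le_if_subset gens)
  have abs_S: "gen_le (artin m) (X_abs m) ?S"
    using std_and_center_subset_X_abs by (intro gen_le_if_subset gens)
  have P_abs: "gen_le (artin m) (X_P m) (X_abs m)"
    using P_S std_and_center_le_X_abs by (rule gen_le_trans)
  have P_P: "gen_le (artin m) (X_P m) (X_P m)" by (intro gen_le_if_subset gens order.refl)
  \<comment> \<open>Otherwise the chain from \<open>?S\<close> through \<open>X_abs\<close> and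
    \<open>X_NP\<close> would put \<open>?S\<close> below \<open>X_P\<close>, which the powers of a
    generator exclude.\<close>
  have "\<not> gen_le (artin m) (X_abs m) (X_NP m)"
    using not_std_and_center_le_X_P std_and_center_le_X_abs NP_P gen_le_trans by metis
  moreover have "gen_le (artin m) (X_NP m) (X_abs m)" using NP_P P_abs by (rule gen_le_trans)
  moreover have "ediameter (word_metric (artin m) X) = \<infinity>" if "X \<in> {X_P m, X_NP m, X_abs m, ?S}" for X
    using that ediameter_infinite_if_gen_le gens P_P X_P_le_X_NP P_abs P_S by blast
  ultimately show ?thesis
    using X_P_le_X_NP NP_P std_and_center_le_X_abs abs_S
      hyperbolic_X_P hyperbolic_X_NP hyperbolic_X_abs hyperbolic_std_and_center
    unfolding gen_equiv_def by blast
qed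

end
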